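(* Let $\mathfrak g$ be a mixed Lie superalgebra over $R$. Then $\overline{\mathfrak g}:=\mathfrak g/t\mathfrak g$ has a natural structure of a Lie superalgebra in $\mathrm{Ver}_4^+(k)$. Namely, with $D$ and the bracket induced by $d$ and the bracket of $\mathfrak g$, with $\overline{\mathfrak g}_0=\mathfrak g_0/t\mathfrak g_0$ and $\overline{\mathfrak g}_1=\mathfrak g_1/t\mathfrak g_1$ regarded as subspaces of $\overline{\mathfrak g}$, where $\mathfrak g_0=\operatorname{Ker}d$ and $\mathfrak g_1=\operatorname{Ker}(d-t)$, and with the quadratic map $\overline q:\overline{\mathfrak g}_1\to\overline{\mathfrak g}_0$ induced by $q:\mathfrak g_1\to\mathfrak g_0$, $q(y)=\frac12[y,y]$, the object $\overline{\mathfrak g}$ is a Lie superalgebra in $\mathrm{Ver}_4^+(k)$.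
   Context: Mixed setting: $R$ is a complete DVR of characteristic $0$ with maximal ideal $\mathfrak m$ and perfect residue field $k$ of characteristic $2$, such that $2$ generates $\mathfrak m^2$; $t$ is a uniformizer with $t^2/2\in 1+tR$. $S=R[d]/(d(d-t))$ is a Hopf algebra over $R$ with $\Delta(d)=d\otimes1+1\otimes d-2t^{-1}d\otimes d$, $\varepsilon(d)=0$. $\mathrm{MixsVect}_R$ is the category of $S$-modules that are topologically free over $R$ (torsion-free, $\mathfrak m$-adically separated and complete), with ($\mathfrak m$-adically completed) tensor product over $R$, $S$ acting via $\Delta$, and symmetric braiding $c(x\otimes y)=y\otimes x-2t^{-2}dy\otimes dx$. An operadic mixed Lie superalgebra over $R$ is an object $\mathfrak g$ of $\mathrm{MixsVect}_R$ with a morphism $\beta=[\,,]:\mathfrak g\otimes\mathfrak g\to\mathfrak g$ (so $d[x,y]=[dx,y]+[x,dy]-2t^{-1}[dx,dy]$) with $\beta\circ(\mathrm{id}+(12))=0$ (i.e. $[x,y]=-[y,x]+2t^{-2}[dy,dx]$) and $\beta\circ(\beta\otimes\mathrm{id})\circ(\mathrm{id}+(123)+(132))=0$, where permutations act on tensor powers through $c$. It is a mixed Lie superalgebra if $[y,y]\in2\mathfrak g$ for all $y\in\mathfrak g$ with $dy=ty$. $\mathrm{Ver}_4^+(k)$ is the symmetric tensor category of (possibly infinite dimensional) $k$-vector spaces $V$ with a linear map $D:V\to V$, $D^2=0$ (write $x'=Dx$); on $V\otimes W$, $D(v\otimes w)=v'\otimes w+v\otimes w'$; the braiding is $c(v\otimes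 w)=w\otimes v+w'\otimes v'$. An operadic Lie algebra in $\mathrm{Ver}_4^+(k)$ is an object $L$ with a $k$-bilinear bracket such that for all $x,y,z$: $[x,y]'=[x',y]+[x,y']$; $[x,y]=[y,x]+[y',x']$; and $[[x,y],z]+[[z,x],y]+[[y,z],x]+[[x',y],z']+[[z',x],y']+[[y',z],x']=0$. It is a Lie algebra if moreover $[x,x]=0$ whenever $x'=0$. A super-structure on $L$ is a pair of subspaces $\operatorname{Im}D\subset L_0,L_1\subset\operatorname{Ker}D$ with $L_0\cap L_1=\operatorname{Im}D$ and $L_0+L_1=\operatorname{Ker}D$. A map $Q$ is quadratic if $Q(\lambda y)=\lambda^2Q(y)$ for scalars $\lambda$ and $Q(y_1+y_2)-Q(y_1)-Q(y_2)$ is bilinear. A Lie superalgebra in $\mathrm{Ver}_4^+(k)$ is a Lie algebra $L$ in $\mathrm{Ver}_4^+(k)$ with a super-structure $L_0,L_1$ such that $[L_i,L_j]\subset L_{i+j}$ (indices mod $2$), and a quadratic map $Q:L_1\to L_0$ such that $Q(x')=[x,x]$ for $x\in L$; $Q(y_1+y_2)-Q(y_1)-Q(y_2)=[y_1,y_2]$ for $y_1,y_2\in L_1$; $[Q(y),x]=[y,[y,x]]$ for $y\in L_1$, $x\in L$. *)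

theory Defs
  imports "HOL-Algebra.Algebra"
begin

section \<open>Base rings\<close>

definition has_characteristic :: "('a, 'r) ring_scheme \<Rightarrow> nat \<Rightarrow> bool" where
  "has_characteristic R p \<longleftrightarrow> (\<forall>n::nat. [n] \<cdot>\<^bsub>R\<^esub> \<one>\<^bsub>R\<^esub> = \<zero>\<^bsub>R\<^esub> \<longleftrightarrow> p dvd n)"

locale perfect_field_char_two = field K for K (structure) +
  assumes char_two: "has_characteristic K 2"
    and frobenius_surj: "\<forall>a\<in>carrier K. \<exists>b\<in>carrier K. b [^] (2::nat) = a"

text \<open>
  For a decreasing filtration \<open>N 0, N 1, \<dots>\<close> of an abelian group \<open>G\<close> by subgroups, this says that
  \<open>G\<close> maps bijectively onto the inverse limit of the quotients \<open>G / N n\<close>.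
\<close>
definition complete_separated :: "('b, 'm) ring_scheme \<Rightarrow> (nat \<Rightarrow> 'b set) \<Rightarrow> bool" where
  "complete_separated G N \<longleftrightarrow>
     (\<Inter>n. N n) = {\<zero>\<^bsub>G\<^esub>} \<and>
     (\<forall>s. (\<forall>n. s n \<in> carrier G) \<and> (\<forall>n. s (Suc n) \<ominus>\<^bsub>G\<^esub> s n \<in> N n) \<longrightarrow>
          (\<exists>x\<in>carrier G. \<forall>n. x \<ominus>\<^bsub>G\<^esub> s n \<in> N n))"

abbreviation ideal_power :: "('a, 'r) ring_scheme \<Rightarrow> 'a set \<Rightarrow> nat \<Rightarrow> 'a set" where
  "ideal_power R I n \<equiv> I [^]\<^bsub>ideals_set R\<^esub> n"

definition adic_filtration ::
  "('a, 'r) ring_scheme \<Rightarrow> 'a set \<Rightarrow> ('a, 'b, 'm) module_scheme \<Rightarrow> nat \<Rightarrow> 'b set" where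
  "adic_filtration R I M n =
     generate (add_monoid M) {a \<odot>\<^bsub>M\<^esub> x | a x. a \<in> ideal_power R I n \<and> x \<in> carrier M}"

locale discrete_valuation_ring = principal_domain R for R (structure) and \<mm> +
  assumes maximal: "maximalideal \<mm> R"
    and maximal_unique: "\<And>J. maximalideal J R \<Longrightarrow> J = \<mm>"
    and maximal_nonzero: "\<mm> \<noteq> {\<zero>}"

abbreviation two :: "('a, 'r) ring_scheme \<Rightarrow> 'a" where
  "two R \<equiv> \<one>\<^bsub>R\<^esub> \<oplus>\<^bsub>R\<^esub> \<one>\<^bsub>R\<^esub>"

locale mixed_base_ring = discrete_valuation_ring R \<mm> for R (structure) and \<mm> and t +
  assumes complete: "complete_separated R (ideal_power R \<mm>)"
    and char_zero: "has_characteristic R 0"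
    and residue_field: "perfect_field_char_two (R Quot \<mm>)"
    and two_generates: "ideal_power R \<mm> 2 = PIdl (two R)"
    and t_closed: "t \<in> carrier R"
    and uniformizer: "\<mm> = PIdl t"
    and t_normalized: "\<exists>a\<in>carrier R. t [^] (2::nat) = two R \<otimes> (\<one> \<oplus> t \<otimes> a)"

text \<open>
  Quotient in the fraction field of a domain \<open>R\<close>, to be used only when it lies in \<open>R\<close>.  Over a mixed
  base ring, both \<open>2 / t\<close> and \<open>2 / t\<^sup>2\<close> do.
\<close>
definition exact_quotient :: "('a, 'r) ring_scheme \<Rightarrow> 'a \<Rightarrow> 'a \<Rightarrow> 'a" where
  "exact_quotient R a b = (THE c. c \<in> carrier R \<and> c \<otimes>\<^bsub>R\<^esub> b = a)"

abbreviation two_over_t :: "('a, 'r) ring_scheme \<Rightarrow> 'a \<Rightarrow> 'a" where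
  "two_over_t R t \<equiv> exact_quotient R (two R) t"

abbreviation two_over_t_sq :: "('a, 'r) ring_scheme \<Rightarrow> 'a \<Rightarrow> 'a" where
  "two_over_t_sq R t \<equiv> exact_quotient R (two R) (t [^]\<^bsub>R\<^esub> (2::nat))"


section \<open>Linear, bilinear and quadratic maps\<close>

definition linear_endo ::
  "('a, 'r) ring_scheme \<Rightarrow> ('a, 'b, 'm) module_scheme \<Rightarrow> ('b \<Rightarrow> 'b) \<Rightarrow> bool" where
  "linear_endo R M f \<longleftrightarrow>
     f \<in> carrier M \<rightarrow> carrier M \<and>
     (\<forall>x\<in>carrier M. \<forall>y\<in>carrier M. f (x \<oplus>\<^bsub>M\<^esub> y) = f x \<oplus>\<^bsub>M\<^esub> f y) \<and>
     (\<forall>a\<in>carrier R. \<forall>x\<in>carrier M. f (a \<odot>\<^bsub>M\<^esub> x) = a \<odot>\<^bsub>M\<^esub> f x)"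

text \<open>Here \<open>V\<close> and \<open>W\<close> are submodules of \<open>M\<close>, and the map is from \<open>V \<times> V\<close> to \<open>W\<close>.\<close>
definition bilinear_on ::
  "('a, 'r) ring_scheme \<Rightarrow> ('a, 'b, 'm) module_scheme \<Rightarrow> 'b set \<Rightarrow> 'b set \<Rightarrow> ('b \<Rightarrow> 'b \<Rightarrow> 'b) \<Rightarrow> bool"
  where
  "bilinear_on R M V W f \<longleftrightarrow>
     f \<in> V \<rightarrow> V \<rightarrow> W \<and>
     (\<forall>x\<in>V. \<forall>y\<in>V. \<forall>z\<in>V. f (x \<oplus>\<^bsub>M\<^esub> y) z = f x z \<oplus>\<^bsub>M\<^esub> f y z) \<and>
     (\<forall>x\<in>V. \<forall>y\<in>V. \<forall>z\<in>V. f x (y \<oplus>\<^bsub>M\<^esub> z) = f x y \<oplus>\<^bsub>M\<^esub> f x z) \<and>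
     (\<forall>a\<in>carrier R. \<forall>x\<in>V. \<forall>y\<in>V. f (a \<odot>\<^bsub>M\<^esub> x) y = a \<odot>\<^bsub>M\<^esub> f x y) \<and>
     (\<forall>a\<in>carrier R. \<forall>x\<in>V. \<forall>y\<in>V. f x (a \<odot>\<^bsub>M\<^esub> y) = a \<odot>\<^bsub>M\<^esub> f x y)"

definition quadratic_on ::
  "('a, 'r) ring_scheme \<Rightarrow> ('a, 'b, 'm) module_scheme \<Rightarrow> 'b set \<Rightarrow> 'b set \<Rightarrow> ('b \<Rightarrow> 'b) \<Rightarrow> bool"
  where
  "quadratic_on R M V W Q \<longleftrightarrow>
     Q \<in> V \<rightarrow> W \<and>
     (\<forall>a\<in>carrier R. \<forall>y\<in>V. Q (a \<odot>\<^bsub>M\<^esub> y) = (a [^]\<^bsub>R\<^esub> (2::nat)) \<odot>\<^bsub>M\<^esub> Q y) \<and>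
     bilinear_on R M V W (\<lambda>y z. Q (y \<oplus>\<^bsub>M\<^esub> z) \<ominus>\<^bsub>M\<^esub> Q y \<ominus>\<^bsub>M\<^esub> Q z)"


section \<open>Mixed Lie superalgebras\<close>

text \<open>
  A module over \<open>S = R[d]/(d(d - t))\<close> is an \<open>R\<close>-module with an endomorphism \<open>d\<close> such that
  \<open>d\<^sup>2 = t d\<close>.
\<close>
locale mixed_svect_object = mixed_base_ring R \<mm> t + module R \<gg>
  for R (structure) and \<mm> and t and \<gg> (structure) and d +
  assumes d_linear: "linear_endo R \<gg> d"
    and d_d: "\<And>x. x \<in> carrier \<gg> \<Longrightarrow> d (d x) = t \<odot>\<^bsub>\<gg>\<^esub> d x"
    and torsion_free:
      "\<And>a x. \<lbrakk>a \<in> carrier R; x \<in> carrier \<gg>; a \<odot>\<^bsub>\<gg>\<^esub> x = \<zero>\<^bsub>\<gg>\<^esub>\<rbrakk> \<Longrightarrow> a = \<zero>\<^bsub>R\<^esub> \<or> x = \<zero>\<^bsub>\<gg>\<^esub>"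
    and adically_complete: "complete_separated \<gg> (adic_filtration R \<mm> \<gg>)"

text \<open>
  Since \<open>\<gg>\<close> is separated and complete, \<open>R\<close>-linear maps from the completed tensor powers of \<open>\<gg>\<close> to
  \<open>\<gg>\<close> are the same as \<open>R\<close>-multilinear maps on \<open>\<gg>\<close>.  If the bilinear map \<open>f\<close> corresponds to
  a map \<open>\<phi>\<close> on \<open>\<gg> \<otimes> \<gg>\<close>, then \<open>precomp_braiding R t \<gg> d f\<close> corresponds to \<open>\<phi> \<circ> c\<close>, where
  \<open>c (x \<otimes> y) = y \<otimes> x - 2 t\<^sup>-\<^sup>2 dy \<otimes> dx\<close>.
\<close>
definition precomp_braiding ::
  "('a, 'r) ring_scheme \<Rightarrow> 'a \<Rightarrow> ('a, 'b, 'm) module_scheme \<Rightarrow> ('b \<Rightarrow> 'b) \<Rightarrow>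
   ('b \<Rightarrow> 'b \<Rightarrow> 'b) \<Rightarrow> ('b \<Rightarrow> 'b \<Rightarrow> 'b)" where
  "precomp_braiding R t \<gg> d f = (\<lambda>x y. f y x \<ominus>\<^bsub>\<gg>\<^esub> two_over_t_sq R t \<odot>\<^bsub>\<gg>\<^esub> f (d y) (d x))"

text \<open>Precomposition of a trilinear map with \<open>c \<otimes> id\<close> and with \<open>id \<otimes> c\<close>.\<close>

definition precomp_braiding12 ::
  "('a, 'r) ring_scheme \<Rightarrow> 'a \<Rightarrow> ('a, 'b, 'm) module_scheme \<Rightarrow> ('b \<Rightarrow> 'b) \<Rightarrow>
   ('b \<Rightarrow> 'b \<Rightarrow> 'b \<Rightarrow> 'b) \<Rightarrow> ('b \<Rightarrow> 'b \<Rightarrow> 'b \<Rightarrow> 'b)" where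
  "precomp_braiding12 R t \<gg> d T = (\<lambda>x y z. precomp_braiding R t \<gg> d (\<lambda>x' y'. T x' y' z) x y)"

definition precomp_braiding23 ::
  "('a, 'r) ring_scheme \<Rightarrow> 'a \<Rightarrow> ('a, 'b, 'm) module_scheme \<Rightarrow> ('b \<Rightarrow> 'b) \<Rightarrow>
   ('b \<Rightarrow> 'b \<Rightarrow> 'b \<Rightarrow> 'b) \<Rightarrow> ('b \<Rightarrow> 'b \<Rightarrow> 'b \<Rightarrow> 'b)" where
  "precomp_braiding23 R t \<gg> d T = (\<lambda>x. precomp_braiding R t \<gg> d (T x))"

text \<open>
  In \<open>jacobi\<close>, the two 3-cycles act on the third tensor power as the composites of \<open>c \<otimes> id\<close> and
  \<open>id \<otimes> c\<close> in the two possible orders.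
\<close>
locale operadic_mixed_lie_superalgebra = mixed_svect_object R \<mm> t \<gg> d
  for R (structure) and \<mm> and t and \<gg> (structure) and d and br +
  assumes br_bilinear: "bilinear_on R \<gg> (carrier \<gg>) (carrier \<gg>) br"
    and br_equivariant:
      "\<And>x y. \<lbrakk>x \<in> carrier \<gg>; y \<in> carrier \<gg>\<rbrakk> \<Longrightarrow>
         d (br x y) = br (d x) y \<oplus>\<^bsub>\<gg>\<^esub> br x (d y) \<ominus>\<^bsub>\<gg>\<^esub> two_over_t R t \<odot>\<^bsub>\<gg>\<^esub> br (d x) (d y)"
    and antisymmetry:
      "\<And>x y. \<lbrakk>x \<in> carrier \<gg>; y \<in> carrier \<gg>\<rbrakk> \<Longrightarrow>
         br x y \<oplus>\<^bsub>\<gg>\<^esub> precomp_braiding R t \<gg> d br x y = \<zero>\<^bsub>\<gg>\<^esub>"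
    and jacobi:
      "\<And>x y z. \<lbrakk>x \<in> carrier \<gg>; y \<in> carrier \<gg>; z \<in> carrier \<gg>\<rbrakk> \<Longrightarrow>
         (let T = (\<lambda>x y z. br (br x y) z);
              c12 = precomp_braiding12 R t \<gg> d;
              c23 = precomp_braiding23 R t \<gg> d
          in T x y z \<oplus>\<^bsub>\<gg>\<^esub> c12 (c23 T) x y z \<oplus>\<^bsub>\<gg>\<^esub> c23 (c12 T) x y z) = \<zero>\<^bsub>\<gg>\<^esub>"

definition even_part :: "('b, 'm) ring_scheme \<Rightarrow> ('b \<Rightarrow> 'b) \<Rightarrow> 'b set" where
  "even_part \<gg> d = {x \<in> carrier \<gg>. d x = \<zero>\<^bsub>\<gg>\<^esub>}"

definition odd_part :: "'a \<Rightarrow> ('a, 'b, 'm) module_scheme \<Rightarrow> ('b \<Rightarrow> 'b) \<Rightarrow> 'b set" where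
  "odd_part t \<gg> d = {y \<in> carrier \<gg>. d y = t \<odot>\<^bsub>\<gg>\<^esub> y}"

locale mixed_lie_superalgebra = operadic_mixed_lie_superalgebra R \<mm> t \<gg> d br
  for R (structure) and \<mm> and t and \<gg> (structure) and d and br +
  assumes odd_square_even:
    "\<And>y. y \<in> odd_part t \<gg> d \<Longrightarrow> \<exists>z\<in>carrier \<gg>. br y y = two R \<odot>\<^bsub>\<gg>\<^esub> z"

text \<open>\<open>q y = [y, y] / 2\<close>; the division is unambiguous because \<open>\<gg>\<close> is torsion-free.\<close>
definition half_square ::
  "('a, 'r) ring_scheme \<Rightarrow> ('a, 'b, 'm) module_scheme \<Rightarrow> ('b \<Rightarrow> 'b \<Rightarrow> 'b) \<Rightarrow> 'b \<Rightarrow> 'b" where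
  "half_square R \<gg> br y = (THE z. z \<in> carrier \<gg> \<and> two R \<odot>\<^bsub>\<gg>\<^esub> z = br y y)"


section \<open>Lie superalgebras in \<open>Ver\<^sub>4\<^sup>+\<close>\<close>

locale ver4_object = perfect_field_char_two K + module K L
  for K (structure) and L (structure) and D +
  assumes D_linear: "linear_endo K L D"
    and D_D: "\<And>x. x \<in> carrier L \<Longrightarrow> D (D x) = \<zero>\<^bsub>L\<^esub>"

locale ver4_operadic_lie_algebra = ver4_object K L D
  for K (structure) and L (structure) and D and br +
  assumes br_bilinear: "bilinear_on K L (carrier L) (carrier L) br"
    and br_derivation:
      "\<And>x y. \<lbrakk>x \<in> carrier L; y \<in> carrier L\<rbrakk> \<Longrightarrow> D (br x y) = br (D x) y \<oplus>\<^bsub>L\<^esub> br x (D y)"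
    and br_symmetry:
      "\<And>x y. \<lbrakk>x \<in> carrier L; y \<in> carrier L\<rbrakk> \<Longrightarrow> br x y = br y x \<oplus>\<^bsub>L\<^esub> br (D y) (D x)"
    and br_jacobi:
      "\<And>x y z. \<lbrakk>x \<in> carrier L; y \<in> carrier L; z \<in> carrier L\<rbrakk> \<Longrightarrow>
         br (br x y) z \<oplus>\<^bsub>L\<^esub> br (br z x) y \<oplus>\<^bsub>L\<^esub> br (br y z) x \<oplus>\<^bsub>L\<^esub>
         br (br (D x) y) (D z) \<oplus>\<^bsub>L\<^esub> br (br (D z) x) (D y) \<oplus>\<^bsub>L\<^esub> br (br (D y) z) (D x) = \<zero>\<^bsub>L\<^esub>"

locale ver4_lie_algebra = ver4_operadic_lie_algebra K L D br
  for K (structure) and L (structure) and D and br +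
  assumes br_alternating: "\<And>x. \<lbrakk>x \<in> carrier L; D x = \<zero>\<^bsub>L\<^esub>\<rbrakk> \<Longrightarrow> br x x = \<zero>\<^bsub>L\<^esub>"

locale ver4_super_structure = ver4_object K L D
  for K (structure) and L (structure) and D and L0 and L1 +
  assumes L0_subspace: "submodule L0 K L"
    and L1_subspace: "submodule L1 K L"
    and Im_subset: "D ` carrier L \<subseteq> L0" "D ` carrier L \<subseteq> L1"
    and subset_Ker: "L0 \<subseteq> {x \<in> carrier L. D x = \<zero>\<^bsub>L\<^esub>}" "L1 \<subseteq> {x \<in> carrier L. D x = \<zero>\<^bsub>L\<^esub>}"
    and inter_eq_Im: "L0 \<inter> L1 = D ` carrier L"
    and sum_eq_Ker: "L0 <+>\<^bsub>L\<^esub> L1 = {x \<in> carrier L. D x = \<zero>\<^bsub>L\<^esub>}"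

locale ver4_lie_superalgebra =
  ver4_lie_algebra K L D br + ver4_super_structure K L D L0 L1
  for K (structure) and L (structure) and D and br and L0 and L1 and Q +
  assumes br_00: "\<And>x y. \<lbrakk>x \<in> L0; y \<in> L0\<rbrakk> \<Longrightarrow> br x y \<in> L0"
    and br_01: "\<And>x y. \<lbrakk>x \<in> L0; y \<in> L1\<rbrakk> \<Longrightarrow> br x y \<in> L1"
    and br_10: "\<And>x y. \<lbrakk>x \<in> L1; y \<in> L0\<rbrakk> \<Longrightarrow> br x y \<in> L1"
    and br_11: "\<And>x y. \<lbrakk>x \<in> L1; y \<in> L1\<rbrakk> \<Longrightarrow> br x y \<in> L0"
    and Q_quadratic: "quadratic_on K L L1 L0 Q"
    and Q_D: "\<And>x. x \<in> carrier L \<Longrightarrow> Q (D x) = br x x"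
    and Q_polar: "\<And>y1 y2. \<lbrakk>y1 \<in> L1; y2 \<in> L1\<rbrakk> \<Longrightarrow>
           Q (y1 \<oplus>\<^bsub>L\<^esub> y2) \<ominus>\<^bsub>L\<^esub> Q y1 \<ominus>\<^bsub>L\<^esub> Q y2 = br y1 y2"
    and Q_br: "\<And>y x. \<lbrakk>y \<in> L1; x \<in> carrier L\<rbrakk> \<Longrightarrow> br (Q y) x = br y (br y x)"


section \<open>Reduction modulo \<open>t\<close>\<close>

definition multiples :: "'a \<Rightarrow> ('a, 'b, 'm) module_scheme \<Rightarrow> 'b set \<Rightarrow> 'b set" where
  "multiples t \<gg> A = (\<lambda>x. t \<odot>\<^bsub>\<gg>\<^esub> x) ` A"

text \<open>
  The quotient of an \<open>R\<close>-module \<open>M\<close> by a submodule \<open>N\<close> containing \<open>I M\<close>, as a module over \<open>R / I\<close>.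
  The multiplicative ring fields of a module record carry no meaning and are filled arbitrarily.
\<close>
definition quotient_module ::
  "('a, 'r) ring_scheme \<Rightarrow> 'a set \<Rightarrow> ('a, 'b, 'm) module_scheme \<Rightarrow> 'b set \<Rightarrow> ('a set, 'b set) module"
  where
  "quotient_module R I M N =
     \<lparr>carrier = a_rcosets\<^bsub>M\<^esub> N, monoid.mult = (\<lambda>U V. N), monoid.one = N, ring.zero = N, ring.add = set_add M,
      module.smult = (\<lambda>A U. \<Union>a\<in>A. \<Union>x\<in>U. N +>\<^bsub>M\<^esub> (a \<odot>\<^bsub>M\<^esub> x))\<rparr>"

text \<open>
  The map induced on cosets of \<open>N\<close> by a map \<open>f\<close> defined on \<open>A\<close>, and by a binary map on \<open>M\<close>.  The
  unions are single cosets exactly when the result does not depend on the representatives.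
\<close>
definition induced_map ::
  "('b, 'm) ring_scheme \<Rightarrow> 'b set \<Rightarrow> 'b set \<Rightarrow> ('b \<Rightarrow> 'b) \<Rightarrow> 'b set \<Rightarrow> 'b set" where
  "induced_map M N A f U = (\<Union>x\<in>U \<inter> A. N +>\<^bsub>M\<^esub> f x)"

definition induced_map2 ::
  "('b, 'm) ring_scheme \<Rightarrow> 'b set \<Rightarrow> ('b \<Rightarrow> 'b \<Rightarrow> 'b) \<Rightarrow> 'b set \<Rightarrow> 'b set \<Rightarrow> 'b set" where
  "induced_map2 M N f U V = (\<Union>x\<in>U. \<Union>y\<in>V. N +>\<^bsub>M\<^esub> f x y)"

text \<open>
  The image in \<open>\<gg> / N\<close> of a subset \<open>A\<close> of \<open>\<gg>\<close>.  For \<open>N = t\<gg>\<close> and a submodule \<open>A\<close> with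
  \<open>t\<gg> \<inter> A = tA\<close>, it is \<open>A / tA\<close> regarded as a subspace of \<open>\<gg> / t\<gg>\<close>.
\<close>
definition coset_image :: "('b, 'm) ring_scheme \<Rightarrow> 'b set \<Rightarrow> 'b set \<Rightarrow> 'b set set" where
  "coset_image \<gg> N A = (\<lambda>x. N +>\<^bsub>\<gg>\<^esub> x) ` A"

end

theory Submission
  imports Defs
begin

text \<open>
  Write \<open>w = 2 / t\<^sup>2\<close>.  Since \<open>t\<^sup>2 = 2 (1 + t a)\<close>, this is the inverse of \<open>1 + t a\<close>, so
  \<open>w \<equiv> 1\<close>, \<open>2 / t = w t \<equiv> 0\<close> and \<open>2 = w t\<^sup>2 \<equiv> 0\<close> modulo \<open>t\<close>.  Reducing the operadic axioms with
  these congruences gives the derivation rule and the twisted symmetry at once.  Writing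
  \<open>x' = dx\<close>, the reduced Jacobi identity has \<open>[[y, z'], x'] + [[z', x'], y]\<close> where the target has
  \<open>[[x', y], z']\<close>; the two agree by the same identity at \<open>(x', y, z')\<close>, where all further corrections
  die because \<open>d\<^sup>2 = t d \<equiv> 0\<close>.

  Everything else comes from the fact that \<open>\<gg>\<close> is almost graded: \<open>t x = (t x - d x) + d x\<close> with
  \<open>t x - d x \<in> \<gg>\<^sub>0\<close> and \<open>d x \<in> \<gg>\<^sub>1\<close>.  On homogeneous elements the braiding is the sign rule,
  because \<open>w t\<^sup>2 = 2\<close> turns \<open>y \<otimes> x - w dy \<otimes> dx\<close> into \<open>- y \<otimes> x\<close> when both are odd.  Hence
  \<open>\<gg>\<^sub>0 + \<gg>\<^sub>1\<close> is an ordinary Lie superalgebra, in which \<open>[q y, x] = [y, [y, x]]\<close> holds after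
  doubling; torsion-freeness removes the factor 2 and, by linearity in \<open>x\<close>, extends the identity
  from \<open>t x\<close> to every \<open>x\<close> in \<open>\<gg>\<close> (lemma \<open>q_br\<close>).

  If \<open>d x = t y\<close>, then \<open>y\<close> is odd and \<open>x - y\<close> is even, so the elements \<open>x\<close> with \<open>d x \<in> t \<gg>\<close> are
  exactly those of \<open>\<gg>\<^sub>0 + \<gg>\<^sub>1\<close> (lemma \<open>kernel_mod_t_split\<close>), which gives the super-structure.  For such
  \<open>x = x\<^sub>0 + x\<^sub>1\<close>, moreover, \<open>[x, x] = [x\<^sub>1, x\<^sub>1] = 2 q x\<^sub>1 \<equiv> 0\<close>.
\<close>

section \<open>Quotients of modules\<close>

text \<open>
  The hypothesis \<open>I M \<subseteq> N\<close> is what lets \<open>R / I\<close> act on \<open>M / N\<close>.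
\<close>

locale module_reduction = module R M + I: ideal I R + N: submodule N R M
  for R (structure) and M (structure) and I and N +
  assumes ideal_smult_mem: "\<lbrakk>a \<in> I; x \<in> carrier M\<rbrakk> \<Longrightarrow> a \<odot>\<^bsub>M\<^esub> x \<in> N"

sublocale module_reduction \<subseteq> N: abelian_subgroup N M
  by (rule abelian_subgroupI3)
    (auto intro: additive_subgroup.intro M.abelian_group_axioms N.subgroup_axioms)

context module_reduction
begin

abbreviation quot where
  "quot \<equiv> quotient_module R I M N"

abbreviation proj where
  "proj x \<equiv> N +>\<^bsub>M\<^esub> x"

lemma mem_cosetE:
  assumes "y \<in> proj x"
  obtains n where "n \<in> N" "y = n \<oplus>\<^bsub>M\<^esub> x"
  using assms by (auto simp: a_r_coset_def')

lemma proj_eq_zero_iff: "x \<in> carrier M \<Longrightarrow> proj x = N \<longleftrightarrow> x \<in> N"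
  using N.a_rcos_const N.a_rcos_self by blast

lemma carrier_quot: "carrier quot = proj ` carrier M"
  by (auto simp: quotient_module_def A_RCOSETS_def')

lemma proj_closed [simp]: "x \<in> carrier M \<Longrightarrow> proj x \<in> carrier quot"
  by (simp add: carrier_quot)

lemma proj_cases:
  assumes "U \<in> carrier quot"
  obtains x where "x \<in> carrier M" "U = proj x"
  using assms by (auto simp: carrier_quot)

lemma scalar_cases:
  assumes "A \<in> carrier (R Quot I)"
  obtains a where "a \<in> carrier R" "A = I +> a"
  using assms by (auto simp: FactRing_def A_RCOSETS_def')

lemma proj_add:
  "\<lbrakk>x \<in> carrier M; y \<in> carrier M\<rbrakk> \<Longrightarrow> proj (x \<oplus>\<^bsub>M\<^esub> y) = proj x \<oplus>\<^bsub>quot\<^esub> proj y"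
  by (simp add: quotient_module_def N.a_rcos_sum)

lemma zero_quot: "\<zero>\<^bsub>quot\<^esub> = N"
  by (simp add: quotient_module_def)

lemma proj_zero: "n \<in> N \<Longrightarrow> proj n = \<zero>\<^bsub>quot\<^esub>"
  by (simp add: zero_quot N.a_rcos_const)

lemma coset_absorb: "\<lbrakk>n \<in> N; x \<in> carrier M\<rbrakk> \<Longrightarrow> proj (n \<oplus>\<^bsub>M\<^esub> x) = proj x"
  by (metis N.a_Hcarr N.a_repr_independence' N.a_rcos_module_rev M.add.m_closed M.add.inv_solve_right'
      M.minus_closed M.minus_eq M.add.inv_closed)

lemma proj_zero_M [simp]: "proj \<zero>\<^bsub>M\<^esub> = \<zero>\<^bsub>quot\<^esub>"
  using N.zero_closed by (rule proj_zero)

lemma abelian_group_quot: "abelian_group quot"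
proof (rule abelian_groupI)
  show "\<zero>\<^bsub>quot\<^esub> \<in> carrier quot"
    using proj_closed [OF M.zero_closed] by simp
  fix U assume "U \<in> carrier quot"
  then obtain x where x: "x \<in> carrier M" "U = proj x" by (rule proj_cases)
  show "\<zero>\<^bsub>quot\<^esub> \<oplus>\<^bsub>quot\<^esub> U = U"
    using x proj_add [of "\<zero>\<^bsub>M\<^esub>" x] by simp
  show "\<exists>V\<in>carrier quot. V \<oplus>\<^bsub>quot\<^esub> U = \<zero>\<^bsub>quot\<^esub>"
    using x proj_add [of "\<ominus>\<^bsub>M\<^esub> x" x] by (intro bexI [of _ "proj (\<ominus>\<^bsub>M\<^esub> x)"]) (auto simp: M.l_neg)
qed (auto elim!: proj_cases simp: proj_add [symmetric] M.a_ac)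

lemma proj_smult:
  assumes "a \<in> carrier R" "x \<in> carrier M"
  shows "proj (a \<odot>\<^bsub>M\<^esub> x) = (I +> a) \<odot>\<^bsub>quot\<^esub> proj x"
proof -
  have indep: "proj (b \<odot>\<^bsub>M\<^esub> y) = proj (a \<odot>\<^bsub>M\<^esub> x)" if b: "b \<in> I +> a" and y: "y \<in> proj x" for b y
  proof -
    obtain i n where i: "i \<in> I" "b = i \<oplus> a" and n: "n \<in> N" "y = n \<oplus>\<^bsub>M\<^esub> x"
      using b y by (auto simp: a_r_coset_def')
    have ic: "i \<in> carrier R" using i(1) by (rule I.Icarr)
    have "b \<odot>\<^bsub>M\<^esub> y = (i \<odot>\<^bsub>M\<^esub> y \<oplus>\<^bsub>M\<^esub> a \<odot>\<^bsub>M\<^esub> n) \<oplus>\<^bsub>M\<^esub> a \<odot>\<^bsub>M\<^esub> x"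
      using i n ic assms by (simp add: smult_l_distr smult_r_distr M.a_ac)
    moreover have "i \<odot>\<^bsub>M\<^esub> y \<oplus>\<^bsub>M\<^esub> a \<odot>\<^bsub>M\<^esub> n \<in> N"
      using i n assms by (intro N.a_closed ideal_smult_mem N.smult_closed) auto
    ultimately show ?thesis
      using assms by (simp add: coset_absorb)
  qed
  have "(\<Union>b\<in>I +> a. \<Union>y\<in>proj x. proj (b \<odot>\<^bsub>M\<^esub> y)) = proj (a \<odot>\<^bsub>M\<^esub> x)"
    using assms indep
    by (intro UN_constant_eq [OF I.a_rcos_self] UN_constant_eq [OF N.a_rcos_self] ballI)
  then show ?thesis
    by (simp add: quotient_module_def)
qed

lemma module_quot: "module (R Quot I) quot"
proof (rule moduleI)
  show "cring (R Quot I)" by (rule I.quotient_is_cring) (rule R.is_cring)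
  show "abelian_group quot" by (rule abelian_group_quot)
  have rep: "\<exists>a\<in>carrier R. A = I +> a" if "A \<in> carrier (R Quot I)" for A
    using that by (auto simp: FactRing_def A_RCOSETS_def')
  note hom = ring_hom_add [OF I.rcos_ring_hom, symmetric]
    ring_hom_mult [OF I.rcos_ring_hom, symmetric]
    proj_add [symmetric] proj_smult [symmetric]
  fix A B U V
  assume "A \<in> carrier (R Quot I)" "U \<in> carrier quot"
  then obtain a x where ax: "a \<in> carrier R" "A = I +> a" "x \<in> carrier M" "U = proj x"
    by (auto dest!: rep elim!: proj_cases)
  then show "A \<odot>\<^bsub>quot\<^esub> U \<in> carrier quot" by (simp add: hom)
  {
    assume "V \<in> carrier quot"
    then show "A \<odot>\<^bsub>quot\<^esub> (U \<oplus>\<^bsub>quot\<^esub> V) = A \<odot>\<^bsub>quot\<^esub> U \<oplus>\<^bsub>quot\<^esub> A \<odot>\<^bsub>quot\<^esub> V"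
      using ax by (auto elim!: proj_cases simp: hom smult_r_distr)
  }
  assume "B \<in> carrier (R Quot I)"
  then obtain b where b: "b \<in> carrier R" "B = I +> b" using rep by blast
  show "(A \<oplus>\<^bsub>R Quot I\<^esub> B) \<odot>\<^bsub>quot\<^esub> U = A \<odot>\<^bsub>quot\<^esub> U \<oplus>\<^bsub>quot\<^esub> B \<odot>\<^bsub>quot\<^esub> U"
    using ax b by (simp add: hom smult_l_distr)
  show "(A \<otimes>\<^bsub>R Quot I\<^esub> B) \<odot>\<^bsub>quot\<^esub> U = A \<odot>\<^bsub>quot\<^esub> (B \<odot>\<^bsub>quot\<^esub> U)"
    using ax b by (simp add: hom smult_assoc1)
next
  fix U assume "U \<in> carrier quot"
  then show "\<one>\<^bsub>R Quot I\<^esub> \<odot>\<^bsub>quot\<^esub> U = U"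
    by (auto elim!: proj_cases simp: ring_hom_one [OF I.rcos_ring_hom, symmetric] proj_smult [symmetric])
qed

text \<open>
  A union of cosets indexed by the representatives collapses to one coset as soon as changing the
  representative by \<open>n \<in> N\<close> does not matter; only those \<open>n\<close> count that keep it in the domain \<open>A\<close>.
\<close>
lemma induced_map_proj:
  assumes "x \<in> A" "A \<subseteq> carrier M"
    and "\<And>n. \<lbrakk>n \<in> N; n \<oplus>\<^bsub>M\<^esub> x \<in> A\<rbrakk> \<Longrightarrow> proj (f (n \<oplus>\<^bsub>M\<^esub> x)) = proj (f x)"
  shows "induced_map M N A f (proj x) = proj (f x)"
  unfolding induced_map_def
proof (rule UN_constant_eq)
  show "x \<in> proj x \<inter> A" using assms N.a_rcos_self by auto
  show "\<forall>y\<in>proj x \<inter> A. proj (f y) = proj (f x)"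
  proof
    fix y assume "y \<in> proj x \<inter> A"
    then have "y \<in> proj x" "y \<in> A" by auto
    then obtain n where n: "n \<in> N" "y = n \<oplus>\<^bsub>M\<^esub> x" by (elim mem_cosetE)
    show "proj (f y) = proj (f x)"
      using n(1) \<open>y \<in> A\<close> unfolding n(2) by (rule assms(3))
  qed
qed

lemma induced_map2_proj:
  assumes "x \<in> carrier M" "y \<in> carrier M"
    and "\<And>m n. \<lbrakk>m \<in> N; n \<in> N\<rbrakk> \<Longrightarrow> proj (f (m \<oplus>\<^bsub>M\<^esub> x) (n \<oplus>\<^bsub>M\<^esub> y)) = proj (f x y)"
  shows "induced_map2 M N f (proj x) (proj y) = proj (f x y)"
proof -
  have indep: "proj (f x' y') = proj (f x y)" if x': "x' \<in> proj x" and y': "y' \<in> proj y" for x' y'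
  proof -
    obtain m where m: "m \<in> N" "x' = m \<oplus>\<^bsub>M\<^esub> x" using x' by (rule mem_cosetE)
    obtain n where n: "n \<in> N" "y' = n \<oplus>\<^bsub>M\<^esub> y" using y' by (rule mem_cosetE)
    show ?thesis using m(1) n(1) unfolding m(2) n(2) by (rule assms(3))
  qed
  show ?thesis
    unfolding induced_map2_def using assms(1,2) indep
    by (intro UN_constant_eq [OF N.a_rcos_self] ballI)
qed

lemma submodule_proj_image:
  assumes "submodule A R M"
  shows "submodule (proj ` A) (R Quot I) quot"
proof -
  interpret A: submodule A R M by (rule assms)
  interpret L: module "R Quot I" quot by (rule module_quot)
  have sub: "x \<in> carrier M" if "x \<in> A" for x using A.subset that by auto
  note AE = submoduleE [OF assms]
  show ?thesis
  proof (rule L.submoduleI)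
    show "proj ` A \<subseteq> carrier quot" using sub by auto
    have "\<zero>\<^bsub>M\<^esub> \<in> A" using A.one_closed by simp
    then show "\<zero>\<^bsub>quot\<^esub> \<in> proj ` A" using proj_zero [of "\<zero>\<^bsub>M\<^esub>"] by force
    show "\<ominus>\<^bsub>quot\<^esub> U \<in> proj ` A" if U: "U \<in> proj ` A" for U
    proof -
      obtain x where x: "x \<in> A" "U = proj x" using U by auto
      have "proj (\<ominus>\<^bsub>M\<^esub> x) \<oplus>\<^bsub>quot\<^esub> U = \<zero>\<^bsub>quot\<^esub>"
        using x sub proj_zero [of "\<zero>\<^bsub>M\<^esub>"] by (simp add: proj_add [symmetric] M.l_neg)
      then have "\<ominus>\<^bsub>quot\<^esub> U = proj (\<ominus>\<^bsub>M\<^esub> x)"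
        using x sub by (intro L.minus_equality) auto
      then show ?thesis using AE(3) x by auto
    qed
    show "U \<oplus>\<^bsub>quot\<^esub> V \<in> proj ` A" if "U \<in> proj ` A" "V \<in> proj ` A" for U V
      using that sub AE(5) by (auto simp: proj_add [symmetric])
    show "C \<odot>\<^bsub>quot\<^esub> U \<in> proj ` A" if "C \<in> carrier (R Quot I)" "U \<in> proj ` A" for C U
      using that sub AE(4) by (auto simp: FactRing_def A_RCOSETS_def' proj_smult [symmetric])
  qed
qed

end

section \<open>The element 2 of the base ring\<close>

context mixed_base_ring
begin

lemma t_nonzero: "t \<noteq> \<zero>"
proof
  assume "t = \<zero>"
  then have "\<mm> = {\<zero>}" using uniformizer by (auto simp: cgenideal_def intro: exI [of _ \<zero>])
  then show False using maximal_nonzero by simp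
qed

lemma two_closed [simp]: "two R \<in> carrier R" by simp

lemma two_nonzero: "two R \<noteq> \<zero>"
proof
  assume "two R = \<zero>"
  then have "[(2::nat)] \<cdot> \<one> = \<zero>" by (simp add: numeral_2_eq_2)
  then show False using char_zero by (auto simp: has_characteristic_def)
qed

text \<open>
  The second power of \<open>\<mm> = t R\<close> unfolds to \<open>(R \<mm>) \<mm>\<close>; each generator is a product of two multiples
  of \<open>t\<close>, and multiples of \<open>t\<^sup>2\<close> are closed under sums.
\<close>
lemma two_in_t_squared: "\<exists>w\<in>carrier R. two R = w \<otimes> (t \<otimes> t)"
proof -
  have id: "ideal \<mm> R" using maximal by (rule maximalideal.axioms)
  have sub: "s \<in> {w \<otimes> (t \<otimes> t) | w. w \<in> carrier R}" if "s \<in> ideal_prod R (ideal_prod R (carrier R) \<mm>) \<mm>" for s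
    using that
  proof (induction s rule: ideal_prod.induct)
    case (prod i j)
    have "i \<in> \<mm>" using ideal_prod_inter [OF oneideal id] prod by auto
    then obtain a b where "a \<in> carrier R" "b \<in> carrier R" "i = a \<otimes> t" "j = b \<otimes> t"
      using prod uniformizer by (auto simp: cgenideal_def)
    then have "i \<otimes> j = (a \<otimes> b) \<otimes> (t \<otimes> t)" "a \<otimes> b \<in> carrier R"
      using t_closed by (auto simp: m_ac)
    then show ?case by blast
  next
    case (sum a b)
    then show ?case using t_closed by (auto simp: l_distr [symmetric])
  qed
  have "two R \<in> PIdl (two R)" by (rule cgenideal_self) simp
  then have "two R \<in> ideal_prod R (ideal_prod R (carrier R) \<mm>) \<mm>"
    using two_generates by (simp add: numeral_2_eq_2 ideals_set_def)
  from sub [OF this] show ?thesis by blast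
qed

lemma exact_quotient_eq:
  assumes "c \<in> carrier R" "b \<in> carrier R" "b \<noteq> \<zero>"
  shows "exact_quotient R (c \<otimes> b) b = c"
  unfolding exact_quotient_def using assms m_rcancel by (intro the_equality) auto

abbreviation w where "w \<equiv> two_over_t_sq R t"

text \<open>
  \<open>w\<close> itself mentions 2, so \<open>two_eq\<close> is a rewrite rule only from right to left.
\<close>
lemma w_closed [simp]: "w \<in> carrier R"
  and two_eq: "two R = w \<otimes> (t \<otimes> t)"
  and two_over_t_eq: "two_over_t R t = w \<otimes> t"
proof -
  obtain c where c: "c \<in> carrier R" "two R = c \<otimes> (t \<otimes> t)" using two_in_t_squared by blast
  have "t \<otimes> t \<noteq> \<zero>" using t_nonzero t_closed integral by blast
  then have "exact_quotient R (c \<otimes> (t \<otimes> t)) (t \<otimes> t) = c"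
    using c t_closed by (intro exact_quotient_eq) auto
  then have w: "w = c" using c t_closed by (simp add: numeral_2_eq_2)
  show "w \<in> carrier R" "two R = w \<otimes> (t \<otimes> t)" using w c by auto
  have "exact_quotient R ((c \<otimes> t) \<otimes> t) t = c \<otimes> t"
    using c t_closed t_nonzero by (intro exact_quotient_eq) auto
  then show "two_over_t R t = w \<otimes> t" using c w t_closed by (simp add: m_assoc)
qed

text \<open>
  Cancelling \<open>t\<^sup>2\<close> from \<open>t\<^sup>2 = 2 (1 + t a) = w t\<^sup>2 (1 + t a)\<close> gives \<open>w (1 + t a) = 1\<close>.
\<close>
lemma w_eq_one_mod_t: "\<exists>b\<in>carrier R. w = \<one> \<oplus> t \<otimes> b"
proof -
  obtain a where a: "a \<in> carrier R" "t [^] (2::nat) = two R \<otimes> (\<one> \<oplus> t \<otimes> a)"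
    using t_normalized by blast
  have "t \<otimes> t = t [^] (2::nat)" using t_closed by (simp add: numeral_2_eq_2)
  also note a(2)
  also note two_eq
  also have "(w \<otimes> (t \<otimes> t)) \<otimes> (\<one> \<oplus> t \<otimes> a) = (w \<otimes> (\<one> \<oplus> t \<otimes> a)) \<otimes> (t \<otimes> t)"
    using a(1) t_closed by (simp add: m_ac)
  finally have "\<one> \<otimes> (t \<otimes> t) = (w \<otimes> (\<one> \<oplus> t \<otimes> a)) \<otimes> (t \<otimes> t)"
    using t_closed by simp
  moreover have "t \<otimes> t \<noteq> \<zero>" using t_nonzero t_closed integral by blast
  ultimately have "\<one> = w \<otimes> (\<one> \<oplus> t \<otimes> a)"
    using a(1) t_closed m_rcancel [of "t \<otimes> t" "\<one>" "w \<otimes> (\<one> \<oplus> t \<otimes> a)"] by simp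
  also have "\<dots> = w \<oplus> t \<otimes> (w \<otimes> a)"
    using a(1) t_closed by (simp add: r_distr m_lcomm [of w t a])
  finally have "\<one> \<oplus> t \<otimes> (\<ominus> (w \<otimes> a)) = (w \<oplus> t \<otimes> (w \<otimes> a)) \<oplus> t \<otimes> (\<ominus> (w \<otimes> a))"
    by simp
  also have "\<dots> = w"
    using a(1) t_closed by (simp add: r_minus a_assoc r_neg)
  finally have "w = \<one> \<oplus> t \<otimes> (\<ominus> (w \<otimes> a))" by (rule sym)
  then show ?thesis by (rule bexI) (use a(1) in simp)
qed

end

section \<open>Homogeneous components and reduction modulo \<open>t\<close>\<close>

context mixed_svect_object
begin

lemma d_closed [simp]: "x \<in> carrier \<gg> \<Longrightarrow> d x \<in> carrier \<gg>"
  and d_add: "\<lbrakk>x \<in> carrier \<gg>; y \<in> carrier \<gg>\<rbrakk> \<Longrightarrow> d (x \<oplus>\<^bsub>\<gg>\<^esub> y) = d x \<oplus>\<^bsub>\<gg>\<^esub> d y"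
  and d_smult: "\<lbrakk>a \<in> carrier R; x \<in> carrier \<gg>\<rbrakk> \<Longrightarrow> d (a \<odot>\<^bsub>\<gg>\<^esub> x) = a \<odot>\<^bsub>\<gg>\<^esub> d x"
  using d_linear by (auto simp: linear_endo_def)

lemma d_zero: "d \<zero>\<^bsub>\<gg>\<^esub> = \<zero>\<^bsub>\<gg>\<^esub>"
  using d_smult [of \<zero> "\<zero>\<^bsub>\<gg>\<^esub>"] by simp

lemma d_neg: "x \<in> carrier \<gg> \<Longrightarrow> d (\<ominus>\<^bsub>\<gg>\<^esub> x) = \<ominus>\<^bsub>\<gg>\<^esub> d x"
  using d_smult [of "\<ominus> \<one>" x] by (simp add: smult_l_minus)

lemmas d_simps = d_add d_smult d_zero d_neg d_d

declare t_closed [simp]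

lemma smult_left_cancel:
  assumes "a \<in> carrier R" "a \<noteq> \<zero>" "x \<in> carrier \<gg>" "y \<in> carrier \<gg>" "a \<odot>\<^bsub>\<gg>\<^esub> x = a \<odot>\<^bsub>\<gg>\<^esub> y"
  shows "x = y"
proof -
  have "a \<odot>\<^bsub>\<gg>\<^esub> (x \<oplus>\<^bsub>\<gg>\<^esub> \<ominus>\<^bsub>\<gg>\<^esub> y) = \<zero>\<^bsub>\<gg>\<^esub>"
    using assms by (simp add: smult_r_distr smult_r_minus M.r_neg)
  then have "x \<oplus>\<^bsub>\<gg>\<^esub> \<ominus>\<^bsub>\<gg>\<^esub> y = \<zero>\<^bsub>\<gg>\<^esub>"
    using assms torsion_free [of a "x \<oplus>\<^bsub>\<gg>\<^esub> \<ominus>\<^bsub>\<gg>\<^esub> y"] by simp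
  then show ?thesis using assms M.minus_equality [of x "\<ominus>\<^bsub>\<gg>\<^esub> y"] by simp
qed

lemma two_smult: "x \<in> carrier \<gg> \<Longrightarrow> two R \<odot>\<^bsub>\<gg>\<^esub> x = x \<oplus>\<^bsub>\<gg>\<^esub> x"
  by (simp add: smult_l_distr)

lemma w_t_t_smult: "x \<in> carrier \<gg> \<Longrightarrow> w \<odot>\<^bsub>\<gg>\<^esub> (t \<odot>\<^bsub>\<gg>\<^esub> (t \<odot>\<^bsub>\<gg>\<^esub> x)) = x \<oplus>\<^bsub>\<gg>\<^esub> x"
  by (simp add: two_smult [symmetric] two_eq [symmetric] smult_assoc1 [symmetric])

lemma double_cancel:
  assumes "x \<in> carrier \<gg>" "y \<in> carrier \<gg>" "x \<oplus>\<^bsub>\<gg>\<^esub> x = y \<oplus>\<^bsub>\<gg>\<^esub> y"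
  shows "x = y"
proof (rule smult_left_cancel [OF two_closed two_nonzero assms(1,2)])
  show "two R \<odot>\<^bsub>\<gg>\<^esub> x = two R \<odot>\<^bsub>\<gg>\<^esub> y"
    using assms by (simp only: two_smult)
qed

lemma smult_swap:
  "\<lbrakk>a \<in> carrier R; b \<in> carrier R; x \<in> carrier \<gg>\<rbrakk> \<Longrightarrow> a \<odot>\<^bsub>\<gg>\<^esub> (b \<odot>\<^bsub>\<gg>\<^esub> x) = b \<odot>\<^bsub>\<gg>\<^esub> (a \<odot>\<^bsub>\<gg>\<^esub> x)"
  by (simp add: smult_assoc1 [symmetric] m_comm)

abbreviation g0 where "g0 \<equiv> even_part \<gg> d"
abbreviation g1 where "g1 \<equiv> odd_part t \<gg> d"
abbreviation tg where "tg \<equiv> multiples t \<gg> (carrier \<gg>)"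

lemma even_iff: "x \<in> g0 \<longleftrightarrow> x \<in> carrier \<gg> \<and> d x = \<zero>\<^bsub>\<gg>\<^esub>"
  by (simp add: even_part_def)

lemma odd_iff: "x \<in> g1 \<longleftrightarrow> x \<in> carrier \<gg> \<and> d x = t \<odot>\<^bsub>\<gg>\<^esub> x"
  by (simp add: odd_part_def)

lemma even_closed: "x \<in> g0 \<Longrightarrow> x \<in> carrier \<gg>"
  and odd_closed: "x \<in> g1 \<Longrightarrow> x \<in> carrier \<gg>"
  by (auto simp: even_iff odd_iff)

lemma submodule_even: "submodule g0 R \<gg>"
  by (rule submoduleI) (auto simp: even_iff d_simps)

lemma submodule_odd: "submodule g1 R \<gg>"
  by (rule submoduleI) (auto simp: odd_iff d_simps smult_r_distr smult_r_minus smult_swap)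

lemma submodule_multiples: "submodule tg R \<gg>"
proof (rule submoduleI)
  show "\<zero>\<^bsub>\<gg>\<^esub> \<in> tg" by (auto simp: multiples_def intro!: rev_image_eqI [of "\<zero>\<^bsub>\<gg>\<^esub>"])
qed (auto simp: multiples_def smult_r_distr [symmetric] smult_r_minus [symmetric] smult_swap [of _ t])

lemma smult_t_mem [simp]: "x \<in> carrier \<gg> \<Longrightarrow> t \<odot>\<^bsub>\<gg>\<^esub> x \<in> tg"
  by (simp add: multiples_def)

lemma multiplesE:
  assumes "n \<in> tg"
  obtains z where "z \<in> carrier \<gg>" "n = t \<odot>\<^bsub>\<gg>\<^esub> z"
  using assms by (auto simp: multiples_def)

lemma multiples_inter:
  assumes "submodule A R \<gg>" and div: "\<And>x. \<lbrakk>x \<in> carrier \<gg>; t \<odot>\<^bsub>\<gg>\<^esub> x \<in> A\<rbrakk> \<Longrightarrow> x \<in> A"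
  shows "tg \<inter> A = multiples t \<gg> A"
proof -
  have "x \<in> carrier \<gg>" "t \<odot>\<^bsub>\<gg>\<^esub> x \<in> A" if "x \<in> A" for x
    using that submoduleE(1,4) [OF assms(1)] t_closed by blast+
  then show ?thesis unfolding multiples_def by (blast dest: div)
qed

lemma even_of_smult_t: "\<lbrakk>x \<in> carrier \<gg>; t \<odot>\<^bsub>\<gg>\<^esub> x \<in> g0\<rbrakk> \<Longrightarrow> x \<in> g0"
  using torsion_free [of t "d x"] t_nonzero by (simp add: even_iff d_smult)

lemma odd_of_smult_t: "\<lbrakk>x \<in> carrier \<gg>; t \<odot>\<^bsub>\<gg>\<^esub> x \<in> g1\<rbrakk> \<Longrightarrow> x \<in> g1"
  using smult_left_cancel [OF t_closed t_nonzero, of "d x" "t \<odot>\<^bsub>\<gg>\<^esub> x"] by (simp add: odd_iff d_smult)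

lemma d_odd: "x \<in> carrier \<gg> \<Longrightarrow> d x \<in> g1"
  by (simp add: odd_iff d_d)

text \<open>
  Together with the preceding lemma this is the splitting of \<open>t x\<close> into homogeneous parts.
\<close>
lemma t_minus_d_even: "x \<in> carrier \<gg> \<Longrightarrow> t \<odot>\<^bsub>\<gg>\<^esub> x \<oplus>\<^bsub>\<gg>\<^esub> \<ominus>\<^bsub>\<gg>\<^esub> d x \<in> g0"
  by (simp add: even_iff d_simps M.r_neg)

lemma t_split: "x \<in> carrier \<gg> \<Longrightarrow> (t \<odot>\<^bsub>\<gg>\<^esub> x \<oplus>\<^bsub>\<gg>\<^esub> \<ominus>\<^bsub>\<gg>\<^esub> d x) \<oplus>\<^bsub>\<gg>\<^esub> d x = t \<odot>\<^bsub>\<gg>\<^esub> x"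
  by (simp add: M.a_assoc M.l_neg)

text \<open>
  If \<open>d x = t y\<close>, then \<open>t y\<close> is odd, hence so is \<open>y\<close>, and \<open>d (x - y) = t y - t y = 0\<close>.
\<close>
lemma kernel_mod_t_split:
  assumes "x \<in> carrier \<gg>" "d x \<in> tg"
  obtains x0 x1 where "x0 \<in> g0" "x1 \<in> g1" "x = x0 \<oplus>\<^bsub>\<gg>\<^esub> x1"
proof -
  obtain y where y: "y \<in> carrier \<gg>" "d x = t \<odot>\<^bsub>\<gg>\<^esub> y" using assms by (auto simp: multiples_def)
  have "y \<in> g1"
    using d_odd [OF assms(1)] unfolding y(2) by (rule odd_of_smult_t [OF y(1)])
  moreover from this have "x \<oplus>\<^bsub>\<gg>\<^esub> \<ominus>\<^bsub>\<gg>\<^esub> y \<in> g0"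
    using y assms by (auto simp: even_iff odd_iff d_simps M.r_neg)
  ultimately show thesis
    using assms y by (intro that [of "x \<oplus>\<^bsub>\<gg>\<^esub> \<ominus>\<^bsub>\<gg>\<^esub> y" y]) (auto simp: M.a_assoc M.l_neg)
qed

sublocale red: module_reduction R \<gg> \<mm> tg
proof (intro module_reduction.intro module_reduction_axioms.intro)
  show "module R \<gg>" by unfold_locales
  show "ideal \<mm> R" using maximal by (rule maximalideal.axioms)
  show "submodule tg R \<gg>" by (rule submodule_multiples)
  show "a \<odot>\<^bsub>\<gg>\<^esub> x \<in> tg" if "a \<in> \<mm>" "x \<in> carrier \<gg>" for a x
    using that unfolding uniformizer by (auto simp: cgenideal_def smult_assoc1 smult_swap [of _ t])
qed

end

section \<open>Bracket identities\<close>

context operadic_mixed_lie_superalgebra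
begin

lemma br_closed [simp]: "\<lbrakk>x \<in> carrier \<gg>; y \<in> carrier \<gg>\<rbrakk> \<Longrightarrow> br x y \<in> carrier \<gg>"
  and br_add_left: "\<lbrakk>x \<in> carrier \<gg>; y \<in> carrier \<gg>; z \<in> carrier \<gg>\<rbrakk> \<Longrightarrow>
    br (x \<oplus>\<^bsub>\<gg>\<^esub> y) z = br x z \<oplus>\<^bsub>\<gg>\<^esub> br y z"
  and br_add_right: "\<lbrakk>x \<in> carrier \<gg>; y \<in> carrier \<gg>; z \<in> carrier \<gg>\<rbrakk> \<Longrightarrow>
    br x (y \<oplus>\<^bsub>\<gg>\<^esub> z) = br x y \<oplus>\<^bsub>\<gg>\<^esub> br x z"
  and br_smult_left: "\<lbrakk>a \<in> carrier R; x \<in> carrier \<gg>; y \<in> carrier \<gg>\<rbrakk> \<Longrightarrow>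
    br (a \<odot>\<^bsub>\<gg>\<^esub> x) y = a \<odot>\<^bsub>\<gg>\<^esub> br x y"
  and br_smult_right: "\<lbrakk>a \<in> carrier R; x \<in> carrier \<gg>; y \<in> carrier \<gg>\<rbrakk> \<Longrightarrow>
    br x (a \<odot>\<^bsub>\<gg>\<^esub> y) = a \<odot>\<^bsub>\<gg>\<^esub> br x y"
  using br_bilinear by (auto simp: bilinear_on_def Pi_iff)

lemma br_zero:
  "x \<in> carrier \<gg> \<Longrightarrow> br \<zero>\<^bsub>\<gg>\<^esub> x = \<zero>\<^bsub>\<gg>\<^esub>"
  "x \<in> carrier \<gg> \<Longrightarrow> br x \<zero>\<^bsub>\<gg>\<^esub> = \<zero>\<^bsub>\<gg>\<^esub>"
  using br_smult_left [of \<zero> "\<zero>\<^bsub>\<gg>\<^esub>" x] br_smult_right [of \<zero> x "\<zero>\<^bsub>\<gg>\<^esub>"] by simp_all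

lemma br_neg:
  assumes "x \<in> carrier \<gg>" "y \<in> carrier \<gg>"
  shows "br (\<ominus>\<^bsub>\<gg>\<^esub> x) y = \<ominus>\<^bsub>\<gg>\<^esub> br x y" "br x (\<ominus>\<^bsub>\<gg>\<^esub> y) = \<ominus>\<^bsub>\<gg>\<^esub> br x y"
  using assms br_smult_left [of "\<ominus> \<one>" x y] br_smult_right [of "\<ominus> \<one>" x y]
  by (simp_all add: smult_l_minus)

lemmas br_simps = br_add_left br_add_right br_smult_left br_smult_right br_zero br_neg

lemma neg_zero: "\<ominus>\<^bsub>\<gg>\<^esub> \<zero>\<^bsub>\<gg>\<^esub> = \<zero>\<^bsub>\<gg>\<^esub>"
  by (rule M.minus_equality) simp_all

lemmas module_simps = smult_r_distr smult_r_minus M.minus_eq M.minus_add M.r_neg M.l_neg M.r_neg1 M.r_neg2 M.a_ac neg_zero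

lemma br_flip:
  assumes "x \<in> carrier \<gg>" "y \<in> carrier \<gg>"
  shows "br x y = \<ominus>\<^bsub>\<gg>\<^esub> br y x \<oplus>\<^bsub>\<gg>\<^esub> w \<odot>\<^bsub>\<gg>\<^esub> br (d y) (d x)"
proof -
  have "br x y \<oplus>\<^bsub>\<gg>\<^esub> (br y x \<ominus>\<^bsub>\<gg>\<^esub> w \<odot>\<^bsub>\<gg>\<^esub> br (d y) (d x)) = \<zero>\<^bsub>\<gg>\<^esub>"
    using antisymmetry [OF assms] by (simp add: precomp_braiding_def)
  then have "br x y = \<ominus>\<^bsub>\<gg>\<^esub> (br y x \<ominus>\<^bsub>\<gg>\<^esub> w \<odot>\<^bsub>\<gg>\<^esub> br (d y) (d x))"
    using assms by (intro M.minus_equality [symmetric]) auto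
  then show ?thesis using assms by (simp add: module_simps)
qed

text \<open>
  For odd \<open>x\<close> and \<open>y\<close> the correction \<open>w [dy, dx] = w t\<^sup>2 [y, x] = 2 [y, x]\<close> reverses the sign.
\<close>
lemma br_odd_odd_sym:
  assumes "x \<in> g1" "y \<in> g1"
  shows "br x y = br y x"
  using assms br_flip [of x y] by (simp add: odd_iff br_simps w_t_t_smult module_simps)

lemma br_even_flip:
  assumes "x \<in> g0" "y \<in> carrier \<gg>"
  shows "br x y = \<ominus>\<^bsub>\<gg>\<^esub> br y x"
  using assms br_flip [of x y] by (simp add: even_iff br_simps)

lemma br_even_self: "x \<in> g0 \<Longrightarrow> br x x = \<zero>\<^bsub>\<gg>\<^esub>"
  using br_even_flip [of x x] double_cancel [of "br x x" "\<zero>\<^bsub>\<gg>\<^esub>"] by (metis M.r_neg M.l_zero M.zero_closed br_closed even_closed)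

lemma br_even_even: "\<lbrakk>x \<in> g0; y \<in> g0\<rbrakk> \<Longrightarrow> br x y \<in> g0"
  and br_even_odd: "\<lbrakk>x \<in> g0; y \<in> g1\<rbrakk> \<Longrightarrow> br x y \<in> g1"
  and br_odd_even: "\<lbrakk>x \<in> g1; y \<in> g0\<rbrakk> \<Longrightarrow> br x y \<in> g1"
  by (simp_all add: even_iff odd_iff br_equivariant br_simps two_over_t_eq module_simps)

lemma br_odd_odd: "\<lbrakk>x \<in> g1; y \<in> g1\<rbrakk> \<Longrightarrow> br x y \<in> g0"
  by (simp add: even_iff odd_iff br_equivariant br_simps two_over_t_eq module_simps smult_assoc1
      smult_swap [of t w] w_t_t_smult)

text \<open>
  Each 3-cycle is a composite of two braidings, so it contributes four terms, one for each choice
  of leading or correction term in the two factors.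
\<close>
lemma jacobi_expanded:
  assumes "x \<in> carrier \<gg>" "y \<in> carrier \<gg>" "z \<in> carrier \<gg>"
  shows "br (br x y) z
    \<oplus>\<^bsub>\<gg>\<^esub> ((br (br y z) x \<ominus>\<^bsub>\<gg>\<^esub> w \<odot>\<^bsub>\<gg>\<^esub> br (br y (d z)) (d x))
      \<ominus>\<^bsub>\<gg>\<^esub> w \<odot>\<^bsub>\<gg>\<^esub> (br (br (d y) z) (d x) \<ominus>\<^bsub>\<gg>\<^esub> w \<odot>\<^bsub>\<gg>\<^esub> br (br (d y) (d z)) (d (d x))))
    \<oplus>\<^bsub>\<gg>\<^esub> ((br (br z x) y \<ominus>\<^bsub>\<gg>\<^esub> w \<odot>\<^bsub>\<gg>\<^esub> br (br (d z) (d x)) y)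
      \<ominus>\<^bsub>\<gg>\<^esub> w \<odot>\<^bsub>\<gg>\<^esub> (br (br (d z) x) (d y) \<ominus>\<^bsub>\<gg>\<^esub> w \<odot>\<^bsub>\<gg>\<^esub> br (br (d (d z)) (d x)) (d y))) = \<zero>\<^bsub>\<gg>\<^esub>"
  using jacobi [OF assms]
  unfolding Let_def precomp_braiding12_def precomp_braiding23_def precomp_braiding_def .

text \<open>
  On homogeneous elements the corrections of each 3-cycle are multiples of its leading term, and
  only the Koszul sign remains.
\<close>
lemma jacobi_odd_odd_even:
  assumes "y \<in> g1" "x \<in> g0"
  shows "br (br y y) x \<oplus>\<^bsub>\<gg>\<^esub> \<ominus>\<^bsub>\<gg>\<^esub> br (br y x) y \<oplus>\<^bsub>\<gg>\<^esub> br (br x y) y = \<zero>\<^bsub>\<gg>\<^esub>"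
  using assms jacobi_expanded [of y y x]
  by (simp add: even_iff odd_iff br_simps d_simps w_t_t_smult module_simps)

lemma jacobi_odd_odd_odd:
  assumes "y \<in> g1" "x \<in> g1"
  shows "br (br y y) x \<oplus>\<^bsub>\<gg>\<^esub> br (br y x) y \<oplus>\<^bsub>\<gg>\<^esub> br (br x y) y = \<zero>\<^bsub>\<gg>\<^esub>"
  using assms jacobi_expanded [of y y x]
  by (simp add: even_iff odd_iff br_simps d_simps w_t_t_smult module_simps)

end

section \<open>The squaring map\<close>

context mixed_lie_superalgebra
begin

abbreviation q where "q \<equiv> half_square R \<gg> br"

lemma q_closed: "y \<in> g1 \<Longrightarrow> q y \<in> carrier \<gg>"
  and q_double: "y \<in> g1 \<Longrightarrow> q y \<oplus>\<^bsub>\<gg>\<^esub> q y = br y y"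
  and q_eqI: "\<lbrakk>y \<in> g1; z \<in> carrier \<gg>; z \<oplus>\<^bsub>\<gg>\<^esub> z = br y y\<rbrakk> \<Longrightarrow> q y = z"
proof -
  have eqI: "q y = z" if "z \<in> carrier \<gg>" "z \<oplus>\<^bsub>\<gg>\<^esub> z = br y y" for y z
    unfolding half_square_def
  proof (rule the_equality)
    show "z \<in> carrier \<gg> \<and> two R \<odot>\<^bsub>\<gg>\<^esub> z = br y y" using that by (simp only: two_smult)
    show "z' = z" if "z' \<in> carrier \<gg> \<and> two R \<odot>\<^bsub>\<gg>\<^esub> z' = br y y" for z'
    proof (rule double_cancel)
      show "z' \<oplus>\<^bsub>\<gg>\<^esub> z' = z \<oplus>\<^bsub>\<gg>\<^esub> z"
        using that two_smult [of z'] \<open>z \<oplus>\<^bsub>\<gg>\<^esub> z = br y y\<close> by argo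
    qed (use that \<open>z \<in> carrier \<gg>\<close> in blast)+
  qed
  have "q y \<in> carrier \<gg> \<and> q y \<oplus>\<^bsub>\<gg>\<^esub> q y = br y y" if y: "y \<in> g1" for y
  proof -
    obtain z where "z \<in> carrier \<gg>" "br y y = two R \<odot>\<^bsub>\<gg>\<^esub> z" using odd_square_even [OF y] by blast
    then show ?thesis using eqI [of z y] by (simp only: two_smult)
  qed
  then show "y \<in> g1 \<Longrightarrow> q y \<in> carrier \<gg>" "y \<in> g1 \<Longrightarrow> q y \<oplus>\<^bsub>\<gg>\<^esub> q y = br y y" by auto
  show "\<lbrakk>y \<in> g1; z \<in> carrier \<gg>; z \<oplus>\<^bsub>\<gg>\<^esub> z = br y y\<rbrakk> \<Longrightarrow> q y = z" by (rule eqI)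
qed

lemma q_even: "y \<in> g1 \<Longrightarrow> q y \<in> g0"
  using br_odd_odd [of y y] q_closed [of y] double_cancel [of "d (q y)" "\<zero>\<^bsub>\<gg>\<^esub>"]
  by (simp add: even_iff d_add q_double [symmetric])

lemma q_add:
  assumes "y \<in> g1" "z \<in> g1"
  shows "q (y \<oplus>\<^bsub>\<gg>\<^esub> z) = q y \<oplus>\<^bsub>\<gg>\<^esub> q z \<oplus>\<^bsub>\<gg>\<^esub> br y z"
proof -
  have yz: "y \<in> carrier \<gg>" "z \<in> carrier \<gg>" "y \<oplus>\<^bsub>\<gg>\<^esub> z \<in> g1"
    using assms submoduleE(5) [OF submodule_odd] by (auto simp: odd_closed)
  have "br (y \<oplus>\<^bsub>\<gg>\<^esub> z) (y \<oplus>\<^bsub>\<gg>\<^esub> z) = (q y \<oplus>\<^bsub>\<gg>\<^esub> q y) \<oplus>\<^bsub>\<gg>\<^esub> (q z \<oplus>\<^bsub>\<gg>\<^esub> q z) \<oplus>\<^bsub>\<gg>\<^esub> (br y z \<oplus>\<^bsub>\<gg>\<^esub> br y z)"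
    using yz assms br_odd_odd_sym [of z y] by (simp add: br_simps q_double M.a_ac)
  then show ?thesis
    using yz assms q_closed by (intro q_eqI) (simp_all add: M.a_ac)
qed

lemma q_smult:
  assumes "a \<in> carrier R" "y \<in> g1"
  shows "q (a \<odot>\<^bsub>\<gg>\<^esub> y) = (a [^] (2::nat)) \<odot>\<^bsub>\<gg>\<^esub> q y"
proof (rule q_eqI)
  show "a \<odot>\<^bsub>\<gg>\<^esub> y \<in> g1" using assms submoduleE(4) [OF submodule_odd] by blast
  have a2: "a [^] (2::nat) = a \<otimes> a" using assms by (simp add: numeral_2_eq_2)
  show "(a [^] (2::nat)) \<odot>\<^bsub>\<gg>\<^esub> q y \<oplus>\<^bsub>\<gg>\<^esub> (a [^] (2::nat)) \<odot>\<^bsub>\<gg>\<^esub> q y = br (a \<odot>\<^bsub>\<gg>\<^esub> y) (a \<odot>\<^bsub>\<gg>\<^esub> y)"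
    using assms q_closed odd_closed
    by (simp add: a2 smult_r_distr [symmetric] q_double br_simps smult_assoc1)
qed (use assms q_closed in auto)

text \<open>
  Antisymmetry at \<open>(x, x)\<close> reads \<open>2 [x, x] = w [dx, dx] = 2 w q (dx)\<close>.
\<close>
lemma q_d:
  assumes "x \<in> carrier \<gg>"
  shows "br x x = w \<odot>\<^bsub>\<gg>\<^esub> q (d x)"
proof (rule double_cancel)
  note dx = d_odd [OF assms]
  show "w \<odot>\<^bsub>\<gg>\<^esub> q (d x) \<in> carrier \<gg>" using q_closed [OF dx] by simp
  have "br x x \<oplus>\<^bsub>\<gg>\<^esub> br x x = br x x \<oplus>\<^bsub>\<gg>\<^esub> (\<ominus>\<^bsub>\<gg>\<^esub> br x x \<oplus>\<^bsub>\<gg>\<^esub> w \<odot>\<^bsub>\<gg>\<^esub> br (d x) (d x))"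
    using br_flip [OF assms assms] by simp
  also have "\<dots> = w \<odot>\<^bsub>\<gg>\<^esub> br (d x) (d x)"
    using assms by (simp add: M.r_neg2)
  also have "\<dots> = w \<odot>\<^bsub>\<gg>\<^esub> q (d x) \<oplus>\<^bsub>\<gg>\<^esub> w \<odot>\<^bsub>\<gg>\<^esub> q (d x)"
    using q_closed [OF dx] by (simp add: q_double [OF dx, symmetric] smult_r_distr)
  finally show "br x x \<oplus>\<^bsub>\<gg>\<^esub> br x x = w \<odot>\<^bsub>\<gg>\<^esub> q (d x) \<oplus>\<^bsub>\<gg>\<^esub> w \<odot>\<^bsub>\<gg>\<^esub> q (d x)" .
qed (use assms in simp)

text \<open>
  In both parities the Jacobi identity at \<open>(y, y, x)\<close> and the sign rule give
  \<open>[[y, y], x] = 2 [y, [y, x]]\<close>, which is twice the assertion.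
\<close>
lemma q_br_even:
  assumes "y \<in> g1" "x \<in> g0"
  shows "br (q y) x = br y (br y x)"
proof (rule double_cancel)
  note c = odd_closed [OF assms(1)] even_closed [OF assms(2)]
  show "br (q y) x \<in> carrier \<gg>" "br y (br y x) \<in> carrier \<gg>" using q_closed assms c by auto
  have "br (q y) x \<oplus>\<^bsub>\<gg>\<^esub> br (q y) x = br (br y y) x"
    using q_closed assms c by (simp add: br_add_left [symmetric] q_double)
  also have "br (br y y) x = br (br y x) y \<oplus>\<^bsub>\<gg>\<^esub> br (br y x) y"
  proof -
    have "br (br x y) y = \<ominus>\<^bsub>\<gg>\<^esub> br (br y x) y"
      using br_even_flip [OF assms(2) c(1)] c by (simp add: br_neg)
    then have "br (br y y) x \<oplus>\<^bsub>\<gg>\<^esub> \<ominus>\<^bsub>\<gg>\<^esub> (br (br y x) y \<oplus>\<^bsub>\<gg>\<^esub> br (br y x) y) = \<zero>\<^bsub>\<gg>\<^esub>"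
      using jacobi_odd_odd_even [OF assms] c by (simp add: M.minus_add M.a_ac)
    then show ?thesis
      using c M.minus_equality [of "br (br y y) x" "\<ominus>\<^bsub>\<gg>\<^esub> (br (br y x) y \<oplus>\<^bsub>\<gg>\<^esub> br (br y x) y)"]
      by (simp del: M.minus_add)
  qed
  also have "br (br y x) y = br y (br y x)"
    using assms by (intro br_odd_odd_sym br_odd_even)
  finally show "br (q y) x \<oplus>\<^bsub>\<gg>\<^esub> br (q y) x = br y (br y x) \<oplus>\<^bsub>\<gg>\<^esub> br y (br y x)" .
qed

lemma q_br_odd:
  assumes "y \<in> g1" "x \<in> g1"
  shows "br (q y) x = br y (br y x)"
proof (rule double_cancel)
  note c = odd_closed [OF assms(1)] odd_closed [OF assms(2)]
  show "br (q y) x \<in> carrier \<gg>" "br y (br y x) \<in> carrier \<gg>" using q_closed assms c by auto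
  have "br (q y) x \<oplus>\<^bsub>\<gg>\<^esub> br (q y) x = br (br y y) x"
    using q_closed assms c by (simp add: br_add_left [symmetric] q_double)
  also have "br (br y y) x = \<ominus>\<^bsub>\<gg>\<^esub> br (br y x) y \<oplus>\<^bsub>\<gg>\<^esub> \<ominus>\<^bsub>\<gg>\<^esub> br (br y x) y"
  proof -
    have "br (br y y) x \<oplus>\<^bsub>\<gg>\<^esub> (br (br y x) y \<oplus>\<^bsub>\<gg>\<^esub> br (br y x) y) = \<zero>\<^bsub>\<gg>\<^esub>"
      using jacobi_odd_odd_odd [OF assms] br_odd_odd_sym [OF assms] c by (simp add: M.a_ac)
    then show ?thesis
      using c M.minus_equality [of "br (br y y) x" "br (br y x) y \<oplus>\<^bsub>\<gg>\<^esub> br (br y x) y"]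
      by (simp add: M.minus_add)
  qed
  also have "\<ominus>\<^bsub>\<gg>\<^esub> br (br y x) y = br y (br y x)"
    using assms c br_even_flip [OF br_odd_odd [OF assms] c(1)] by simp
  finally show "br (q y) x \<oplus>\<^bsub>\<gg>\<^esub> br (q y) x = br y (br y x) \<oplus>\<^bsub>\<gg>\<^esub> br y (br y x)" .
qed

text \<open>
  Both sides are linear in \<open>x\<close>, so multiplying by \<open>t\<close> reduces to the homogeneous parts of \<open>t x\<close>.
\<close>
lemma q_br:
  assumes "y \<in> g1" "x \<in> carrier \<gg>"
  shows "br (q y) x = br y (br y x)"
proof (rule smult_left_cancel [OF t_closed t_nonzero])
  define x0 where "x0 = t \<odot>\<^bsub>\<gg>\<^esub> x \<oplus>\<^bsub>\<gg>\<^esub> \<ominus>\<^bsub>\<gg>\<^esub> d x"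
  have x0: "x0 \<in> g0" and dx: "d x \<in> g1" and x: "t \<odot>\<^bsub>\<gg>\<^esub> x = x0 \<oplus>\<^bsub>\<gg>\<^esub> d x"
    using assms t_minus_d_even d_odd t_split by (auto simp: x0_def)
  note c = odd_closed [OF assms(1)] even_closed [OF x0] assms(2) q_closed [OF assms(1)]
  show "br (q y) x \<in> carrier \<gg>" "br y (br y x) \<in> carrier \<gg>" using c by auto
  have "t \<odot>\<^bsub>\<gg>\<^esub> br (q y) x = br (q y) (x0 \<oplus>\<^bsub>\<gg>\<^esub> d x)"
    using c by (simp add: x [symmetric] br_smult_right)
  also have "\<dots> = br y (br y (x0 \<oplus>\<^bsub>\<gg>\<^esub> d x))"
    using c q_br_even [OF assms(1) x0] q_br_odd [OF assms(1) dx] by (simp add: br_add_right)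
  also have "\<dots> = t \<odot>\<^bsub>\<gg>\<^esub> br y (br y x)"
    using c by (simp add: x [symmetric] br_smult_right)
  finally show "t \<odot>\<^bsub>\<gg>\<^esub> br (q y) x = t \<odot>\<^bsub>\<gg>\<^esub> br y (br y x)" .
qed

end

section \<open>The reduction as a Lie superalgebra\<close>

sublocale mixed_svect_object \<subseteq> L: module "R Quot \<mm>" "quotient_module R \<mm> \<gg> (multiples t \<gg> (carrier \<gg>))"
  by (rule red.module_quot)

context mixed_svect_object
begin

abbreviation proj where "proj \<equiv> red.proj"
abbreviation gbar where "gbar \<equiv> red.quot"
abbreviation D where "D \<equiv> induced_map \<gg> tg (carrier \<gg>) d"
abbreviation g0bar where "g0bar \<equiv> coset_image \<gg> tg g0"
abbreviation g1bar where "g1bar \<equiv> coset_image \<gg> tg g1"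

lemma proj_t_smult: "x \<in> carrier \<gg> \<Longrightarrow> proj (t \<odot>\<^bsub>\<gg>\<^esub> x) = \<zero>\<^bsub>gbar\<^esub>"
  by (simp add: red.proj_zero)

lemma proj_w_smult:
  assumes "x \<in> carrier \<gg>"
  shows "proj (w \<odot>\<^bsub>\<gg>\<^esub> x) = proj x"
proof -
  obtain b where b: "b \<in> carrier R" "w = \<one> \<oplus> t \<otimes> b" using w_eq_one_mod_t by blast
  have "w \<odot>\<^bsub>\<gg>\<^esub> x = t \<odot>\<^bsub>\<gg>\<^esub> (b \<odot>\<^bsub>\<gg>\<^esub> x) \<oplus>\<^bsub>\<gg>\<^esub> x"
    unfolding b(2) using assms b(1) by (simp add: smult_l_distr smult_assoc1 M.a_comm)
  then show ?thesis using assms b(1) by (simp add: red.coset_absorb)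
qed

lemma gbar_double:
  assumes "U \<in> carrier gbar"
  shows "U \<oplus>\<^bsub>gbar\<^esub> U = \<zero>\<^bsub>gbar\<^esub>"
proof -
  obtain x where x: "x \<in> carrier \<gg>" "U = proj x" using assms by (rule red.proj_cases)
  have "x \<oplus>\<^bsub>\<gg>\<^esub> x = t \<odot>\<^bsub>\<gg>\<^esub> (t \<odot>\<^bsub>\<gg>\<^esub> (w \<odot>\<^bsub>\<gg>\<^esub> x))"
    using x(1) by (simp add: w_t_t_smult [symmetric] smult_swap [of t w])
  then show ?thesis using x by (simp add: red.proj_add [symmetric] proj_t_smult)
qed

lemma gbar_neg: "U \<in> carrier gbar \<Longrightarrow> \<ominus>\<^bsub>gbar\<^esub> U = U"
  by (rule L.M.minus_equality) (simp_all add: gbar_double)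

text \<open>
  Signs disappear in \<open>\<gg> / t\<gg>\<close>, so equations there are proved by moving everything to one side.
\<close>
lemma gbar_eqI: "\<lbrakk>U \<in> carrier gbar; V \<in> carrier gbar; U \<oplus>\<^bsub>gbar\<^esub> V = \<zero>\<^bsub>gbar\<^esub>\<rbrakk> \<Longrightarrow> U = V"
  by (metis L.M.minus_equality gbar_neg)

lemma gbar_double_left:
  "\<lbrakk>U \<in> carrier gbar; V \<in> carrier gbar\<rbrakk> \<Longrightarrow> U \<oplus>\<^bsub>gbar\<^esub> (U \<oplus>\<^bsub>gbar\<^esub> V) = V"
  by (simp add: L.M.a_assoc [symmetric] gbar_double)

lemma proj_neg: "x \<in> carrier \<gg> \<Longrightarrow> proj (\<ominus>\<^bsub>\<gg>\<^esub> x) = proj x"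
  by (rule gbar_eqI) (simp_all add: red.proj_add [symmetric] M.l_neg)

lemmas proj_simps = red.proj_add proj_neg proj_t_smult proj_w_smult M.minus_eq

lemma D_proj: "x \<in> carrier \<gg> \<Longrightarrow> D (proj x) = proj (d x)"
  by (rule red.induced_map_proj) (auto elim!: multiplesE simp: d_add d_smult red.coset_absorb)

lemma mem_g0bar: "U \<in> g0bar \<longleftrightarrow> (\<exists>x\<in>g0. U = proj x)"
  and mem_g1bar: "U \<in> g1bar \<longleftrightarrow> (\<exists>x\<in>g1. U = proj x)"
  by (auto simp: coset_image_def)

lemma ver4_object_gbar: "ver4_object (R Quot \<mm>) gbar D"
proof (intro ver4_object.intro ver4_object_axioms.intro)
  show "perfect_field_char_two (R Quot \<mm>)" by (rule residue_field)
  show "module (R Quot \<mm>) gbar" by (rule red.module_quot)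
  show "linear_endo (R Quot \<mm>) gbar D"
    unfolding linear_endo_def
    by (auto elim!: red.proj_cases red.scalar_cases
        simp: D_proj d_add d_smult red.proj_add [symmetric] red.proj_smult [symmetric])
  show "D (D U) = \<zero>\<^bsub>gbar\<^esub>" if "U \<in> carrier gbar" for U
    using that by (auto elim!: red.proj_cases simp: D_proj d_d proj_t_smult)
qed

lemma proj_d_zero_iff: "x \<in> carrier \<gg> \<Longrightarrow> D (proj x) = \<zero>\<^bsub>gbar\<^esub> \<longleftrightarrow> d x \<in> tg"
  by (simp add: D_proj red.zero_quot red.proj_eq_zero_iff)

text \<open>
  The image of \<open>D\<close> is even as well as odd because \<open>dx \<equiv> t x - dx\<close>.  Conversely, if \<open>x\<^sub>1 = x\<^sub>0 + t z\<close>
  with \<open>x\<^sub>i\<close> of parity \<open>i\<close>, applying \<open>d\<close> gives \<open>t x\<^sub>1 = t dz\<close>, so \<open>x\<^sub>1 = dz\<close>.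
\<close>
lemma ver4_super_structure_gbar: "ver4_super_structure (R Quot \<mm>) gbar D g0bar g1bar"
proof (intro ver4_super_structure.intro ver4_super_structure_axioms.intro)
  show "ver4_object (R Quot \<mm>) gbar D" by (rule ver4_object_gbar)
  show "submodule g0bar (R Quot \<mm>) gbar" "submodule g1bar (R Quot \<mm>) gbar"
    unfolding coset_image_def
    by (rule red.submodule_proj_image submodule_even submodule_odd)+
  have im: "D U \<in> g0bar \<inter> g1bar" if U: "U \<in> carrier gbar" for U
  proof -
    obtain x where x: "x \<in> carrier \<gg>" "U = proj x" using U by (rule red.proj_cases)
    have "D U = proj (t \<odot>\<^bsub>\<gg>\<^esub> x \<oplus>\<^bsub>\<gg>\<^esub> \<ominus>\<^bsub>\<gg>\<^esub> d x)"
      using x by (simp add: D_proj proj_simps)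
    then show ?thesis
      using x t_minus_d_even d_odd by (auto simp: mem_g0bar mem_g1bar D_proj)
  qed
  then show "D ` carrier gbar \<subseteq> g0bar" "D ` carrier gbar \<subseteq> g1bar" by auto
  have ker: "proj x \<in> {U \<in> carrier gbar. D U = \<zero>\<^bsub>gbar\<^esub>}" if "x \<in> g0 \<or> x \<in> g1" for x
  proof -
    have "x \<in> carrier \<gg>" "d x \<in> tg"
      using that red.N.zero_closed by (auto simp: even_iff odd_iff)
    then show ?thesis by (simp add: proj_d_zero_iff)
  qed
  then show "g0bar \<subseteq> {U \<in> carrier gbar. D U = \<zero>\<^bsub>gbar\<^esub>}" "g1bar \<subseteq> {U \<in> carrier gbar. D U = \<zero>\<^bsub>gbar\<^esub>}"
    by (auto simp: coset_image_def)
  show "g0bar \<inter> g1bar = D ` carrier gbar"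
  proof
    show "D ` carrier gbar \<subseteq> g0bar \<inter> g1bar" using im by auto
    show "g0bar \<inter> g1bar \<subseteq> D ` carrier gbar"
    proof
      fix U assume "U \<in> g0bar \<inter> g1bar"
      then obtain x0 x1 where x: "x0 \<in> g0" "x1 \<in> g1" "U = proj x0" "U = proj x1"
        by (auto simp: mem_g0bar mem_g1bar)
      then have c: "x0 \<in> carrier \<gg>" "x1 \<in> carrier \<gg>" by (auto simp: even_closed odd_closed)
      have "x1 \<in> proj x0" using red.N.a_rcos_self [OF c(2)] x(3,4) by simp
      then obtain n where n: "n \<in> tg" "x1 = n \<oplus>\<^bsub>\<gg>\<^esub> x0" by (rule red.mem_cosetE)
      obtain z where "z \<in> carrier \<gg>" "n = t \<odot>\<^bsub>\<gg>\<^esub> z" using n(1) by (rule multiplesE)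
      then have z: "z \<in> carrier \<gg>" "x1 = t \<odot>\<^bsub>\<gg>\<^esub> z \<oplus>\<^bsub>\<gg>\<^esub> x0" using n(2) by auto
      have "t \<odot>\<^bsub>\<gg>\<^esub> x1 = d x1" using x by (simp add: odd_iff)
      also have "\<dots> = t \<odot>\<^bsub>\<gg>\<^esub> d z" using x(1) z c by (simp add: even_iff d_simps)
      finally have "x1 = d z"
        using smult_left_cancel [OF t_closed t_nonzero c(2) d_closed [OF z(1)]] by blast
      then show "U \<in> D ` carrier gbar" using x(4) z(1) by (auto simp: D_proj [symmetric])
    qed
  qed
  show "g0bar <+>\<^bsub>gbar\<^esub> g1bar = {U \<in> carrier gbar. D U = \<zero>\<^bsub>gbar\<^esub>}"
  proof
    show "{U \<in> carrier gbar. D U = \<zero>\<^bsub>gbar\<^esub>} \<subseteq> g0bar <+>\<^bsub>gbar\<^esub> g1bar"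
    proof
      fix U assume "U \<in> {U \<in> carrier gbar. D U = \<zero>\<^bsub>gbar\<^esub>}"
      then have U: "U \<in> carrier gbar" "D U = \<zero>\<^bsub>gbar\<^esub>" by auto
      obtain x where x: "x \<in> carrier \<gg>" "U = proj x" using U(1) by (rule red.proj_cases)
      have "d x \<in> tg" using U(2) x by (simp add: proj_d_zero_iff)
      obtain x0 x1 where split: "x0 \<in> g0" "x1 \<in> g1" "x = x0 \<oplus>\<^bsub>\<gg>\<^esub> x1"
        using x(1) \<open>d x \<in> tg\<close> by (rule kernel_mod_t_split)
      then have "U = proj x0 \<oplus>\<^bsub>gbar\<^esub> proj x1"
        using x(2) by (simp add: even_closed odd_closed red.proj_add)
      moreover have "proj x0 \<in> g0bar" "proj x1 \<in> g1bar"
        using split(1,2) mem_g0bar mem_g1bar by blast+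
      ultimately show "U \<in> g0bar <+>\<^bsub>gbar\<^esub> g1bar"
        unfolding set_add_def' by blast
    qed
    show "g0bar <+>\<^bsub>gbar\<^esub> g1bar \<subseteq> {U \<in> carrier gbar. D U = \<zero>\<^bsub>gbar\<^esub>}"
    proof
      fix U assume "U \<in> g0bar <+>\<^bsub>gbar\<^esub> g1bar"
      then obtain x0 x1 where x: "x0 \<in> g0" "x1 \<in> g1" "U = proj x0 \<oplus>\<^bsub>gbar\<^esub> proj x1"
        unfolding set_add_def' by (auto simp: mem_g0bar mem_g1bar)
      then have "U = proj (x0 \<oplus>\<^bsub>\<gg>\<^esub> x1)" by (simp add: red.proj_add even_closed odd_closed)
      moreover have "x0 \<oplus>\<^bsub>\<gg>\<^esub> x1 \<in> carrier \<gg>" "d (x0 \<oplus>\<^bsub>\<gg>\<^esub> x1) \<in> tg"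
        using x by (auto simp: even_iff odd_iff d_add)
      ultimately show "U \<in> {U \<in> carrier gbar. D U = \<zero>\<^bsub>gbar\<^esub>}"
        using proj_d_zero_iff by auto
    qed
  qed
qed

end

context operadic_mixed_lie_superalgebra
begin

abbreviation brbar where "brbar \<equiv> induced_map2 \<gg> tg br"

lemma brbar_proj:
  assumes "x \<in> carrier \<gg>" "y \<in> carrier \<gg>"
  shows "brbar (proj x) (proj y) = proj (br x y)"
  using assms
  by (intro red.induced_map2_proj) (auto elim!: multiplesE simp: br_simps red.proj_add proj_t_smult)

lemma bilinear_brbar: "bilinear_on (R Quot \<mm>) gbar (carrier gbar) (carrier gbar) brbar"
  unfolding bilinear_on_def
  by (auto elim!: red.proj_cases red.scalar_cases
      simp: brbar_proj br_simps red.proj_add [symmetric] red.proj_smult [symmetric])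

text \<open>
  The reduced mixed identity has \<open>[[y, z'], x'] + [[z', x'], y]\<close> in place of \<open>[[x', y], z']\<close>.  The
  two agree by the same identity at \<open>(x', y, z')\<close>, where every term with a second derivative is 0.
\<close>
lemma brbar_jacobi:
  assumes "x \<in> carrier \<gg>" "y \<in> carrier \<gg>" "z \<in> carrier \<gg>"
  shows "proj (br (br x y) z) \<oplus>\<^bsub>gbar\<^esub> proj (br (br z x) y) \<oplus>\<^bsub>gbar\<^esub> proj (br (br y z) x) \<oplus>\<^bsub>gbar\<^esub>
    proj (br (br (d x) y) (d z)) \<oplus>\<^bsub>gbar\<^esub> proj (br (br (d z) x) (d y)) \<oplus>\<^bsub>gbar\<^esub>
    proj (br (br (d y) z) (d x)) = \<zero>\<^bsub>gbar\<^esub>"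
proof -
  have jac: "proj (br (br x y) z)
      \<oplus>\<^bsub>gbar\<^esub> (proj (br (br y z) x) \<oplus>\<^bsub>gbar\<^esub> proj (br (br y (d z)) (d x)) \<oplus>\<^bsub>gbar\<^esub> proj (br (br (d y) z) (d x)))
      \<oplus>\<^bsub>gbar\<^esub> (proj (br (br z x) y) \<oplus>\<^bsub>gbar\<^esub> proj (br (br (d z) (d x)) y) \<oplus>\<^bsub>gbar\<^esub> proj (br (br (d z) x) (d y)))
      = \<zero>\<^bsub>gbar\<^esub>"
    if "x \<in> carrier \<gg>" "y \<in> carrier \<gg>" "z \<in> carrier \<gg>" for x y z
    using arg_cong [OF jacobi_expanded [OF that], of proj] that
    by (simp add: proj_simps d_d br_simps)
  have pair: "proj (br (br (d x) y) (d z)) \<oplus>\<^bsub>gbar\<^esub>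
      (proj (br (br y (d z)) (d x)) \<oplus>\<^bsub>gbar\<^esub> proj (br (br (d z) (d x)) y)) = \<zero>\<^bsub>gbar\<^esub>"
    using jac [of "d x" y "d z"] assms by (simp add: d_d br_simps proj_t_smult L.M.a_assoc)
  have "proj (br (br (d x) y) (d z)) =
      proj (br (br y (d z)) (d x)) \<oplus>\<^bsub>gbar\<^esub> proj (br (br (d z) (d x)) y)"
    by (intro gbar_eqI [OF _ _ pair]) (use assms in simp_all)
  then show ?thesis
    using jac [OF assms] assms by (simp add: L.M.a_ac)
qed

end

context mixed_lie_superalgebra
begin

abbreviation qbar where "qbar \<equiv> induced_map \<gg> tg g1 q"

text \<open>
  Two odd representatives of a coset differ by an odd element of \<open>t\<gg>\<close>, which is \<open>t z\<close> with \<open>z\<close> odd,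
  and \<open>q (t z + y) = t\<^sup>2 q z + q y + t [z, y]\<close>.
\<close>
lemma qbar_proj:
  assumes "y \<in> g1"
  shows "qbar (proj y) = proj (q y)"
proof (rule red.induced_map_proj)
  show "g1 \<subseteq> carrier \<gg>" by (auto simp: odd_closed)
  fix n assume n: "n \<in> tg" "n \<oplus>\<^bsub>\<gg>\<^esub> y \<in> g1"
  have yc: "y \<in> carrier \<gg>" and nc: "n \<in> carrier \<gg>" using assms n by (auto simp: odd_closed)
  have "(n \<oplus>\<^bsub>\<gg>\<^esub> y) \<oplus>\<^bsub>\<gg>\<^esub> \<ominus>\<^bsub>\<gg>\<^esub> y \<in> g1"
    using n(2) assms submoduleE(3,5) [OF submodule_odd] by blast
  then have "n \<in> g1" using yc nc by (simp add: M.a_assoc M.r_neg)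
  then have "n \<in> multiples t \<gg> g1"
    using n(1) multiples_inter [OF submodule_odd odd_of_smult_t] by blast
  then obtain z where z: "z \<in> g1" "n = t \<odot>\<^bsub>\<gg>\<^esub> z" by (auto simp: multiples_def)
  have "q (n \<oplus>\<^bsub>\<gg>\<^esub> y) = q n \<oplus>\<^bsub>\<gg>\<^esub> q y \<oplus>\<^bsub>\<gg>\<^esub> br n y"
    using \<open>n \<in> g1\<close> assms by (rule q_add)
  also have "\<dots> = t \<odot>\<^bsub>\<gg>\<^esub> (t \<odot>\<^bsub>\<gg>\<^esub> q z) \<oplus>\<^bsub>\<gg>\<^esub> q y \<oplus>\<^bsub>\<gg>\<^esub> t \<odot>\<^bsub>\<gg>\<^esub> br z y"
    using z odd_closed [OF z(1)] yc q_closed [OF z(1)]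
    by (simp add: q_smult br_smult_left numeral_2_eq_2 smult_assoc1)
  finally show "proj (q (n \<oplus>\<^bsub>\<gg>\<^esub> y)) = proj (q y)"
    using odd_closed [OF z(1)] yc q_closed [OF z(1)] q_closed [OF assms]
    by (simp add: red.proj_add proj_t_smult)
qed (rule assms)

lemma ver4_lie_algebra_gbar: "ver4_lie_algebra (R Quot \<mm>) gbar D brbar"
proof (intro ver4_lie_algebra.intro ver4_operadic_lie_algebra.intro
    ver4_lie_algebra_axioms.intro ver4_operadic_lie_algebra_axioms.intro)
  show "ver4_object (R Quot \<mm>) gbar D" by (rule ver4_object_gbar)
  show "bilinear_on (R Quot \<mm>) gbar (carrier gbar) (carrier gbar) brbar" by (rule bilinear_brbar)
  fix U V assume "U \<in> carrier gbar"
  then obtain x where x: "x \<in> carrier \<gg>" "U = proj x" by (rule red.proj_cases)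
  {
    assume "V \<in> carrier gbar"
    then obtain y where y: "y \<in> carrier \<gg>" "V = proj y" by (rule red.proj_cases)
    show "D (brbar U V) = brbar (D U) V \<oplus>\<^bsub>gbar\<^esub> brbar U (D V)"
      using x y by (simp add: D_proj brbar_proj br_equivariant two_over_t_eq proj_simps smult_assoc1)
    show "brbar U V = brbar V U \<oplus>\<^bsub>gbar\<^esub> brbar (D V) (D U)"
      using x y arg_cong [OF br_flip [of x y], of proj] by (simp add: D_proj brbar_proj proj_simps)
    fix W assume "W \<in> carrier gbar"
    then obtain z where z: "z \<in> carrier \<gg>" "W = proj z" by (rule red.proj_cases)
    show "brbar (brbar U V) W \<oplus>\<^bsub>gbar\<^esub> brbar (brbar W U) V \<oplus>\<^bsub>gbar\<^esub> brbar (brbar V W) U \<oplus>\<^bsub>gbar\<^esub>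
        brbar (brbar (D U) V) (D W) \<oplus>\<^bsub>gbar\<^esub> brbar (brbar (D W) U) (D V) \<oplus>\<^bsub>gbar\<^esub>
        brbar (brbar (D V) W) (D U) = \<zero>\<^bsub>gbar\<^esub>"
      using x y z brbar_jacobi [of x y z] by (simp add: D_proj brbar_proj)
  }
  assume "D U = \<zero>\<^bsub>gbar\<^esub>"
  then have "d x \<in> tg" using x by (simp add: proj_d_zero_iff)
  with x(1) obtain x0 x1 where h: "x0 \<in> g0" "x1 \<in> g1" "x = x0 \<oplus>\<^bsub>\<gg>\<^esub> x1"
    by (rule kernel_mod_t_split)
  note c = even_closed [OF h(1)] odd_closed [OF h(2)]
  have "br x x = q x1 \<oplus>\<^bsub>\<gg>\<^esub> q x1"
    using c h br_even_self [OF h(1)] br_even_flip [OF h(1) c(2)]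
    by (simp add: br_simps q_double M.l_neg M.a_assoc M.r_neg2 M.r_neg1)
  then show "brbar U U = \<zero>\<^bsub>gbar\<^esub>"
    using x q_closed [OF h(2)] by (simp add: brbar_proj red.proj_add gbar_double)
qed

lemma brbar_polar:
  assumes "U \<in> g1bar" "V \<in> g1bar"
  shows "qbar (U \<oplus>\<^bsub>gbar\<^esub> V) \<ominus>\<^bsub>gbar\<^esub> qbar U \<ominus>\<^bsub>gbar\<^esub> qbar V = brbar U V"
proof -
  obtain y z where y: "y \<in> g1" "U = proj y" and z: "z \<in> g1" "V = proj z"
    using assms by (auto simp: mem_g1bar)
  have yz: "y \<oplus>\<^bsub>\<gg>\<^esub> z \<in> g1" using y z submoduleE(5) [OF submodule_odd] by blast
  note c = odd_closed [OF y(1)] odd_closed [OF z(1)] q_closed [OF y(1)] q_closed [OF z(1)]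
  have "qbar (U \<oplus>\<^bsub>gbar\<^esub> V) = proj (q y) \<oplus>\<^bsub>gbar\<^esub> proj (q z) \<oplus>\<^bsub>gbar\<^esub> proj (br y z)"
    using y z c qbar_proj [OF yz] by (simp add: red.proj_add q_add)
  then show ?thesis
    using y z c
    by (simp add: qbar_proj brbar_proj L.M.minus_eq gbar_neg L.M.a_ac gbar_double gbar_double_left)
qed

lemma quadratic_qbar: "quadratic_on (R Quot \<mm>) gbar g1bar g0bar qbar"
proof -
  interpret S: ver4_super_structure "R Quot \<mm>" gbar D g0bar g1bar
    by (rule ver4_super_structure_gbar)
  have sub: "U \<in> carrier gbar" if "U \<in> g1bar" for U using S.subset_Ker that by auto
  note closed = L.submoduleE(4,5) [OF S.L1_subspace]
  have "brbar \<in> g1bar \<rightarrow> g1bar \<rightarrow> g0bar"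
    by (auto simp: mem_g0bar mem_g1bar brbar_proj odd_closed) (metis br_odd_odd)
  then have "bilinear_on (R Quot \<mm>) gbar g1bar g0bar (\<lambda>U V. qbar (U \<oplus>\<^bsub>gbar\<^esub> V) \<ominus>\<^bsub>gbar\<^esub> qbar U \<ominus>\<^bsub>gbar\<^esub> qbar V)"
    using bilinear_brbar sub closed unfolding bilinear_on_def by (simp add: brbar_polar Pi_iff)
  moreover have "qbar \<in> g1bar \<rightarrow> g0bar"
    by (auto simp: mem_g0bar mem_g1bar qbar_proj) (metis q_even)
  moreover have "qbar (A \<odot>\<^bsub>gbar\<^esub> U) = (A [^]\<^bsub>R Quot \<mm>\<^esub> (2::nat)) \<odot>\<^bsub>gbar\<^esub> qbar U"
    if A: "A \<in> carrier (R Quot \<mm>)" and U: "U \<in> g1bar" for A U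
  proof -
    obtain a where a: "a \<in> carrier R" "A = \<mm> +> a" using A by (rule red.scalar_cases)
    obtain y where y: "y \<in> g1" "U = proj y" using U by (auto simp: mem_g1bar)
    have ay: "a \<odot>\<^bsub>\<gg>\<^esub> y \<in> g1" using a y submoduleE(4) [OF submodule_odd] by blast
    have "A [^]\<^bsub>R Quot \<mm>\<^esub> (2::nat) = \<mm> +> (a [^] (2::nat))"
      using a ring_hom_mult [OF red.I.rcos_ring_hom, of a a] ring_hom_closed [OF red.I.rcos_ring_hom, of a]
      by (simp add: numeral_2_eq_2)
    then show ?thesis
      using a y odd_closed [OF y(1)] q_closed [OF y(1)]
      by (simp add: red.proj_smult [symmetric] qbar_proj [OF ay] qbar_proj q_smult)
  qed
  ultimately show ?thesis unfolding quadratic_on_def by blast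
qed

lemma ver4_lie_superalgebra_gbar: "ver4_lie_superalgebra (R Quot \<mm>) gbar D brbar g0bar g1bar qbar"
proof (intro ver4_lie_superalgebra.intro ver4_lie_superalgebra_axioms.intro)
  show "ver4_lie_algebra (R Quot \<mm>) gbar D brbar" by (rule ver4_lie_algebra_gbar)
  show "ver4_super_structure (R Quot \<mm>) gbar D g0bar g1bar" by (rule ver4_super_structure_gbar)
  show "quadratic_on (R Quot \<mm>) gbar g1bar g0bar qbar" by (rule quadratic_qbar)
  show "qbar (D U) = brbar U U" if U: "U \<in> carrier gbar" for U
  proof -
    obtain x where x: "x \<in> carrier \<gg>" "U = proj x" using U by (rule red.proj_cases)
    then show ?thesis
      using q_closed [OF d_odd [OF x(1)]]
      by (simp add: D_proj qbar_proj d_odd brbar_proj q_d proj_w_smult)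
  qed
  show "brbar (qbar Y) U = brbar Y (brbar Y U)" if "Y \<in> g1bar" "U \<in> carrier gbar" for Y U
    using that
    by (auto elim!: red.proj_cases simp: mem_g1bar qbar_proj brbar_proj q_br q_closed odd_closed)
qed (auto simp: mem_g0bar mem_g1bar brbar_proj even_closed odd_closed brbar_polar
    intro: br_even_even br_even_odd br_odd_even br_odd_odd)

end

theorem proposition3p16:
  fixes R :: "('a, 'r) ring_scheme" and \<mm> :: "'a set" and t :: 'a
    and \<gg> :: "('a, 'b, 'm) module_scheme" and d :: "'b \<Rightarrow> 'b" and br :: "'b \<Rightarrow> 'b \<Rightarrow> 'b"
  assumes "mixed_lie_superalgebra R \<mm> t \<gg> d br"
  shows "let tg = multiples t \<gg> (carrier \<gg>);
             g0 = even_part \<gg> d;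
             g1 = odd_part t \<gg> d;
             q = half_square R \<gg> br;
             gbar = quotient_module R \<mm> \<gg> tg;
             D = induced_map \<gg> tg (carrier \<gg>) d;
             brbar = induced_map2 \<gg> tg br;
             g0bar = coset_image \<gg> tg g0;
             g1bar = coset_image \<gg> tg g1;
             qbar = induced_map \<gg> tg g1 q
         in (\<forall>y\<in>g1. q y \<in> g0 \<and> two R \<odot>\<^bsub>\<gg>\<^esub> q y = br y y) \<and>
            tg \<inter> g0 = multiples t \<gg> g0 \<and>
            tg \<inter> g1 = multiples t \<gg> g1 \<and>
            (\<forall>x\<in>carrier \<gg>. D (tg +>\<^bsub>\<gg>\<^esub> x) = tg +>\<^bsub>\<gg>\<^esub> d x) \<and>
            (\<forall>x\<in>carrier \<gg>. \<forall>y\<in>carrier \<gg>.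
               brbar (tg +>\<^bsub>\<gg>\<^esub> x) (tg +>\<^bsub>\<gg>\<^esub> y) = tg +>\<^bsub>\<gg>\<^esub> br x y) \<and>
            (\<forall>y\<in>g1. qbar (tg +>\<^bsub>\<gg>\<^esub> y) = tg +>\<^bsub>\<gg>\<^esub> q y) \<and>
            ver4_lie_superalgebra (R Quot \<mm>) gbar D brbar g0bar g1bar qbar"
proof -
  interpret mixed_lie_superalgebra R \<mm> t \<gg> d br by (rule assms)
  have "\<forall>y\<in>g1. q y \<in> g0 \<and> two R \<odot>\<^bsub>\<gg>\<^esub> q y = br y y"
  proof (intro ballI conjI)
    fix y assume y: "y \<in> g1"
    show "q y \<in> g0" using y by (rule q_even)
    show "two R \<odot>\<^bsub>\<gg>\<^esub> q y = br y y" using q_double [OF y] q_closed [OF y] by (simp only: two_smult)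
  qed
  then show ?thesis
    unfolding Let_def
    using multiples_inter [OF submodule_even even_of_smult_t]
      multiples_inter [OF submodule_odd odd_of_smult_t]
      D_proj brbar_proj qbar_proj ver4_lie_superalgebra_gbar
    by blast
qed

end
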